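(* Let $f:\operatorname{dom} f\subseteq\mathbb{R}^n\to\mathbb{R}$ be $\mathcal{C}^4$ on $B_n(x^0;\overline{\Delta})$, where $x^0\in\operatorname{dom} f$ is the point of interest and $\overline{\Delta}>0$. Denote by $L_{\nabla^2 f}\ge0$ and $L_{\nabla^3 f}\ge0$ the Lipschitz constants of $\nabla^2 f$ and $\nabla^3 f$ on $\overline{B}_n(x^0;\overline{\Delta})$, respectively. Let $\widetilde{S}\in\mathbb{R}^{n\times(n-1)}$ be a partial diagonal matrix with full column rank whose $n$-th row equals $\mathbf{0}_{n-1}^\top$, and let $S=\begin{bmatrix}s^1&\cdots&s^m\end{bmatrix}\in\mathbb{R}^{n\times m}$ be formed by a non-empty subset of the columns of $\widetilde{S}$. Let $T=\begin{bmatrix}t^1&\cdots&t^n\end{bmatrix}\in\mathbb{R}^{n\times n}$ be a diagonal matrix with full column rank. For each $j\in\{1,\dots,m\}$, let $u_j$ be the index of the non-zero entry of $s^j$, let $\widetilde{T}_j=\begin{bmatrix}t^{u_j+1}&\cdots&t^{n-1}&t^n\end{bmatrix}\in\mathbb{R}^{n\times(n-u_j)}$, and let $T_j\in\mathbb{R}^{n\times k_j}$ be formed by a (non-empty) subset of the columns of $\widetilde{T}_j$. Assume that $B_n(x^0+s^j;\Delta_{T_j})\subset B_n(x^0;\overline{\Delta})$ for all $j\in\{1,\dots,m\}$. Let $U\in\mathbb{R}^{n\times n}$ be the strictly upper triangular matrix with $U_{i,j}=[\nabla^2 f(x^0)]_{i,j}$ if $1\le i<j\le n$ and $U_{i,j}=0$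 otherwise. Then (i) $$\left\|\operatorname{P}_{S,T_{1:m}}\nabla_s^2 f(x^0;S,T_{1:m})-\operatorname{P}_{S,T_{1:m}}\nabla^2 f(x^0)\right\|=\left\|\nabla_s^2 f(x^0;S,T_{1:m})-\operatorname{P}_{S,T_{1:m}}U\right\|\le 4m\sqrt{k}\,L_{\nabla^2 f}\left(\frac{\Delta_u}{\Delta_l}\right)^2\|(\widehat{S}^\top)^\dagger\|\,\|\widehat{T}^\dagger\|\,\Delta_u,$$ and (ii) $$\left\|\operatorname{P}_{S,T_{1:m}}\nabla_c^2 f(x^0;S,T_{1:m})-\operatorname{P}_{S,T_{1:m}}\nabla^2 f(x^0)\right\|=\left\|\nabla_c^2 f(x^0;S,T_{1:m})-\operatorname{P}_{S,T_{1:m}}U\right\|\le 2m\sqrt{k}\,L_{\nabla^3 f}\left(\frac{\Delta_u}{\Delta_l}\right)^2\|(\widehat{S}^\top)^\dagger\|\,\|\widehat{T}^\dagger\|\,\Delta_u^2.$$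
   Context: $\|\cdot\|$ is the Euclidean norm on vectors and the induced (spectral) norm on matrices. $B_n(x;\Delta)$ and $\overline{B}_n(x;\Delta)$ are the open and closed balls in $\mathbb{R}^n$ centered at $x$ of radius $\Delta$. $A^\dagger$ is the Moore-Penrose pseudoinverse of a real matrix $A$ (vectors in $\mathbb{R}^n$ are $n\times1$ matrices). $e_m^j$ is the $j$-th standard basis vector of $\mathbb{R}^m$. $\oplus$ is the Minkowski sum; a matrix is identified with the set of its columns. Generalized simplex gradient: for a matrix $T=\begin{bmatrix}t^1&\cdots&t^k\end{bmatrix}\in\mathbb{R}^{n\times k}$ and a point $x$ with $x\in\operatorname{dom} f$ and $x\oplus T\subset\operatorname{dom} f$, $\nabla_s f(x;T)=(T^\top)^\dagger\,\delta_s f(x;T)\in\mathbb{R}^n$, where $\delta_s f(x;T)=\big(f(x+t^1)-f(x),\dots,f(x+t^k)-f(x)\big)^\top\in\mathbb{R}^k$. Generalized simplex Hessian: for $S=\begin{bmatrix}s^1&\cdots&s^m\end{bmatrix}\in\mathbb{R}^{n\times m}$ and $T_{1:m}=\{T_1,\dots,T_m\}$ with $T_j\in\mathbb{R}^{n\times k_j}$, such that $x^0\oplus T_j$, $x^0\oplus S$, $x^0+s^j\oplus T_j$ are contained in $\operatorname{dom} f$ for all $j$, $\nabla_s^2 f(x^0;S,T_{1:m})=(S^\top)^\dagger\,\delta_s^2 f(x^0;S,T_{1:m})\in\mathbb{R}^{n\times n}$, where $\delta_s^2 f(x^0;S,T_{1:m})\in\mathbb{R}^{m\times n}$ is the matrix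 whose $j$-th row is $\big(\nabla_s f(x^0+s^j;T_j)-\nabla_s f(x^0;T_j)\big)^\top$. Generalized centered simplex Hessian: $\nabla_c^2 f(x^0;S,T_{1:m})=\tfrac12\big(\nabla_s^2 f(x^0;S,T_{1:m})+\nabla_s^2 f(x^0;-S,-T_{1:m})\big)$, where $-T_{1:m}=\{-T_1,\dots,-T_m\}$; it is defined when $x^0\oplus S\oplus T_j$, $x^0\oplus(-S)\oplus(-T_j)$, $x^0\oplus(\pm S)$ and $x^0\oplus(\pm T_j)$ are contained in $\operatorname{dom} f$ for all $j$. Projection operator: for $M\in\mathbb{R}^{n\times n}$, $\operatorname{P}_{S,T_{1:m}}M=\sum_{j=1}^m(S^\top)^\dagger e_m^j(e_m^j)^\top S^\top M\,T_jT_j^\dagger$. Partial diagonal matrix: $M\in\mathbb{R}^{n\times m}$, $m\le n$, is a partial diagonal matrix if there exists a diagonal matrix $D\in\mathbb{R}^{n\times n}$ such that for each column $Me^j$, $j\in\{1,\dots,m\}$, there is a distinct index $i\in\{1,\dots,n\}$ (different columns of $M$ get different indices) with $Me^j=De^i$. Radii and normalized matrices: $\Delta_S=\max_j\|s^j\|$; $\Delta_{T_j}$ is the maximum norm of a column of $T_j$; $\widehat{S}=S/\Delta_S$; $\widehat{T_j}=T_j/\Delta_{T_j}$; $\Delta_u=\max\{\Delta_S,\Delta_{T_1},\dots,\Delta_{T_m}\}$; $\Delta_l=\min\{\Delta_S,\Delta_{T_1},\dots,\Delta_{T_m}\}$; $\widehat{T}$ is a matrix $\widehat{T_j}$ for which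 $\|\widehat{T_j}^\dagger\|$ is maximal over $j\in\{1,\dots,m\}$; $k=\max\{k_1,\dots,k_m\}$. Standing assumptions: all points required by these definitions lie in $\operatorname{dom} f$; $S$ and all $T_j$ are non-empty with non-null rank. *)

theory Defs
  imports
    "HOL-Analysis.L2_Norm"
    "HOL-Analysis.Derivative"
    "Jordan_Normal_Form.DL_Rank"
begin

text \<open>
  Since the matrices involved have column numbers that vary with an index, vectors and matrices
  are those of \<^theory>\<open>Jordan_Normal_Form.Matrix\<close>, and \<open>\<real>\<^sup>n\<close> is \<open>carrier_vec n\<close>.
  All indices are 0-based.
\<close>

definition vnorm :: "real vec \<Rightarrow> real" where
  "vnorm v = L2_set (\<lambda>i. v $ i) {..<dim_vec v}"

definition mat_norm :: "real mat \<Rightarrow> real" where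
  "mat_norm A = (SUP v \<in> {v \<in> carrier_vec (dim_col A). vnorm v \<le> 1}. vnorm (A *\<^sub>v v))"

definition trilinear_norm :: "nat \<Rightarrow> (nat \<Rightarrow> nat \<Rightarrow> nat \<Rightarrow> real) \<Rightarrow> real" where
  "trilinear_norm n A =
    (SUP (u, v, w) \<in> {(u, v, w). u \<in> carrier_vec n \<and> v \<in> carrier_vec n \<and> w \<in> carrier_vec n \<and>
                        vnorm u \<le> 1 \<and> vnorm v \<le> 1 \<and> vnorm w \<le> 1}.
       \<bar>\<Sum>i<n. \<Sum>j<n. \<Sum>k<n. A i j k * u $ i * v $ j * w $ k\<bar>)"

definition vball :: "nat \<Rightarrow> real vec \<Rightarrow> real \<Rightarrow> real vec set" where
  "vball n x r = {y \<in> carrier_vec n. vnorm (y - x) < r}"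

definition continuous_on_vec :: "real vec set \<Rightarrow> (real vec \<Rightarrow> real) \<Rightarrow> bool" where
  "continuous_on_vec X f \<longleftrightarrow>
    (\<forall>x\<in>X. \<forall>\<epsilon>>0. \<exists>\<delta>>0. \<forall>y\<in>X. vnorm (y - x) < \<delta> \<longrightarrow> \<bar>f y - f x\<bar> < \<epsilon>)"

definition coord_line :: "nat \<Rightarrow> nat \<Rightarrow> (real vec \<Rightarrow> real) \<Rightarrow> real vec \<Rightarrow> real \<Rightarrow> real" where
  "coord_line n i f x = (\<lambda>t. f (x + t \<cdot>\<^sub>v unit_vec n i))"

definition partial_deriv :: "nat \<Rightarrow> nat \<Rightarrow> (real vec \<Rightarrow> real) \<Rightarrow> real vec \<Rightarrow> real" where
  "partial_deriv n i f x = deriv (coord_line n i f x) 0"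

text \<open>
  \<open>C_k_on n k X f\<close>, for \<open>X\<close> open in \<open>\<real>\<^sup>n\<close>: all partial derivatives of \<open>f\<close> of order at most \<open>k\<close>
  exist and are continuous on \<open>X\<close>.
\<close>

primrec C_k_on :: "nat \<Rightarrow> nat \<Rightarrow> real vec set \<Rightarrow> (real vec \<Rightarrow> real) \<Rightarrow> bool" where
  "C_k_on n 0 X f = continuous_on_vec X f"
| "C_k_on n (Suc k) X f =
    (continuous_on_vec X f \<and>
     (\<forall>i<n. (\<forall>x\<in>X. coord_line n i f x field_differentiable at 0) \<and>
            C_k_on n k X (partial_deriv n i f)))"

definition hessian :: "nat \<Rightarrow> (real vec \<Rightarrow> real) \<Rightarrow> real vec \<Rightarrow> real mat" where
  "hessian n f x = mat n n (\<lambda>(i, j). partial_deriv n i (partial_deriv n j f) x)"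

definition third_deriv :: "nat \<Rightarrow> (real vec \<Rightarrow> real) \<Rightarrow> real vec \<Rightarrow> nat \<Rightarrow> nat \<Rightarrow> nat \<Rightarrow> real" where
  "third_deriv n f x i j k = partial_deriv n i (partial_deriv n j (partial_deriv n k f)) x"

text \<open>
  These are meaningful only where the derivatives exist: on the boundary of a ball in whose interior
  \<open>f\<close> is \<open>C\<^sup>4\<close>, the values of \<^const>\<open>deriv\<close> are arbitrary.  They are therefore applied to the open ball;
  a Lipschitz constant of the (continuously extended) derivatives on the closed ball is the same thing.
  The third derivative is measured by its operator norm as a trilinear form.
\<close>

definition hessian_lipschitz :: "nat \<Rightarrow> real \<Rightarrow> real vec set \<Rightarrow> (real vec \<Rightarrow> real) \<Rightarrow> bool" where
  "hessian_lipschitz n L X f \<longleftrightarrow>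
    (\<forall>x\<in>X. \<forall>y\<in>X. mat_norm (hessian n f x - hessian n f y) \<le> L * vnorm (x - y))"

definition third_deriv_lipschitz :: "nat \<Rightarrow> real \<Rightarrow> real vec set \<Rightarrow> (real vec \<Rightarrow> real) \<Rightarrow> bool" where
  "third_deriv_lipschitz n L X f \<longleftrightarrow>
    (\<forall>x\<in>X. \<forall>y\<in>X.
       trilinear_norm n (\<lambda>i j k. third_deriv n f x i j k - third_deriv n f y i j k)
         \<le> L * vnorm (x - y))"

definition is_pinv :: "real mat \<Rightarrow> real mat \<Rightarrow> bool" where
  "is_pinv A X \<longleftrightarrow>
     X \<in> carrier_mat (dim_col A) (dim_row A) \<and>
     A * X * A = A \<and> X * A * X = X \<and>
     (A * X)\<^sup>T = A * X \<and> (X * A)\<^sup>T = X * A"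

definition pinv :: "real mat \<Rightarrow> real mat" where
  "pinv A = (THE X. is_pinv A X)"

definition rank_mat :: "real mat \<Rightarrow> nat" where
  "rank_mat A = vec_space.rank (dim_row A) A"

definition full_column_rank :: "real mat \<Rightarrow> bool" where
  "full_column_rank A \<longleftrightarrow> rank_mat A = dim_col A"

definition partial_diagonal :: "real mat \<Rightarrow> bool" where
  "partial_diagonal M \<longleftrightarrow> dim_col M \<le> dim_row M \<and>
     (\<exists>D \<in> carrier_mat (dim_row M) (dim_row M). diagonal_mat D \<and>
       (\<exists>\<iota>. inj_on \<iota> {..<dim_col M} \<and>
            (\<forall>j<dim_col M. \<iota> j < dim_row M \<and> col M j = col D (\<iota> j))))"

text \<open>\<open>A\<close> is formed by a non-empty subset of the columns of \<open>B\<close>, in any order.\<close>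

definition formed_by_columns :: "real mat \<Rightarrow> real mat \<Rightarrow> bool" where
  "formed_by_columns A B \<longleftrightarrow>
     dim_row A = dim_row B \<and> dim_col A > 0 \<and>
     distinct (cols A) \<and> set (cols A) \<subseteq> set (cols B)"

definition columns_after :: "real mat \<Rightarrow> nat \<Rightarrow> real mat" where
  "columns_after T u = mat_of_cols (dim_row T) (map (col T) [u + 1..<dim_col T])"

definition radius :: "real mat \<Rightarrow> real" where
  "radius A = Max ((\<lambda>j. vnorm (col A j)) ` {..<dim_col A})"

definition normalized :: "real mat \<Rightarrow> real mat" where
  "normalized A = (1 / radius A) \<cdot>\<^sub>m A"

definition radius_u :: "real mat \<Rightarrow> (nat \<Rightarrow> real mat) \<Rightarrow> real" where
  "radius_u S Ts = Max (insert (radius S) ((\<lambda>j. radius (Ts j)) ` {..<dim_col S}))"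

definition radius_l :: "real mat \<Rightarrow> (nat \<Rightarrow> real mat) \<Rightarrow> real" where
  "radius_l S Ts = Min (insert (radius S) ((\<lambda>j. radius (Ts j)) ` {..<dim_col S}))"

definition strict_upper :: "real mat \<Rightarrow> real mat" where
  "strict_upper A =
    mat (dim_row A) (dim_col A) (\<lambda>(i, j). if i < j then A $$ (i, j) else 0)"

text \<open>
  The domain of \<open>f\<close> is kept as a separate set \<open>D\<close>, on which the required sample points must lie.
  A family \<open>T\<^sub>1, \<dots>, T\<^sub>m\<close> is a function \<open>Ts\<close> of which only the values \<open>Ts j\<close>, \<open>j < m = dim_col S\<close>,
  matter.
\<close>

definition simplex_delta :: "(real vec \<Rightarrow> real) \<Rightarrow> real vec \<Rightarrow> real mat \<Rightarrow> real vec" where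
  "simplex_delta f x T = vec (dim_col T) (\<lambda>i. f (x + col T i) - f x)"

definition simplex_gradient :: "(real vec \<Rightarrow> real) \<Rightarrow> real vec \<Rightarrow> real mat \<Rightarrow> real vec" where
  "simplex_gradient f x T = pinv (T\<^sup>T) *\<^sub>v simplex_delta f x T"

definition simplex_delta2 ::
  "(real vec \<Rightarrow> real) \<Rightarrow> real vec \<Rightarrow> real mat \<Rightarrow> (nat \<Rightarrow> real mat) \<Rightarrow> real mat" where
  "simplex_delta2 f x S Ts = mat_of_rows (dim_row S)
     (map (\<lambda>j. simplex_gradient f (x + col S j) (Ts j) - simplex_gradient f x (Ts j))
       [0..<dim_col S])"

definition simplex_hessian ::
  "(real vec \<Rightarrow> real) \<Rightarrow> real vec \<Rightarrow> real mat \<Rightarrow> (nat \<Rightarrow> real mat) \<Rightarrow> real mat" where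
  "simplex_hessian f x S Ts = pinv (S\<^sup>T) * simplex_delta2 f x S Ts"

definition simplex_hessian_defined ::
  "real vec set \<Rightarrow> real vec \<Rightarrow> real mat \<Rightarrow> (nat \<Rightarrow> real mat) \<Rightarrow> bool" where
  "simplex_hessian_defined D x S Ts \<longleftrightarrow> x \<in> D \<and>
     (\<forall>s\<in>set (cols S). x + s \<in> D) \<and>
     (\<forall>j<dim_col S. \<forall>t\<in>set (cols (Ts j)). x + t \<in> D \<and> x + col S j + t \<in> D)"

definition centered_simplex_hessian ::
  "(real vec \<Rightarrow> real) \<Rightarrow> real vec \<Rightarrow> real mat \<Rightarrow> (nat \<Rightarrow> real mat) \<Rightarrow> real mat" where
  "centered_simplex_hessian f x S Ts =
     (1 / 2) \<cdot>\<^sub>m (simplex_hessian f x S Ts + simplex_hessian f x (- S) (\<lambda>j. - Ts j))"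

definition centered_simplex_hessian_defined ::
  "real vec set \<Rightarrow> real vec \<Rightarrow> real mat \<Rightarrow> (nat \<Rightarrow> real mat) \<Rightarrow> bool" where
  "centered_simplex_hessian_defined D x S Ts \<longleftrightarrow> x \<in> D \<and>
     (\<forall>s\<in>set (cols S). x + s \<in> D \<and> x - s \<in> D) \<and>
     (\<forall>j<dim_col S. \<forall>t\<in>set (cols (Ts j)). x + t \<in> D \<and> x - t \<in> D \<and>
        (\<forall>s\<in>set (cols S). x + s + t \<in> D \<and> x - s - t \<in> D))"

text \<open>\<open>\<Sum>\<^sub>j (S\<^sup>T)\<^sup>\<dagger> e\<^sup>j (e\<^sup>j)\<^sup>T S\<^sup>T M T\<^sub>j T\<^sub>j\<^sup>\<dagger>\<close>, with \<open>e\<^sup>j\<close> as a column matrix.\<close>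

definition simplex_proj :: "real mat \<Rightarrow> (nat \<Rightarrow> real mat) \<Rightarrow> real mat \<Rightarrow> real mat" where
  "simplex_proj S Ts M =
    (let m = dim_col S; n = dim_row S;
         e = (\<lambda>j. mat_of_cols m [unit_vec m j]);
         summand = (\<lambda>j. pinv (S\<^sup>T) * e j * (e j)\<^sup>T * S\<^sup>T * M * Ts j * pinv (Ts j))
     in mat n n (\<lambda>(a, b). \<Sum>j<m. summand j $$ (a, b)))"

end

theory Submission
  imports Defs
begin

text \<open>
  The columns of \<open>S\<close> and of the \<open>T\<^sub>j\<close> are non-zero multiples of distinct basis vectors, so the
  pseudoinverses are explicit: the simplex Hessian has the entry
  \<open>(f (x + s + t) - f (x + s) - f (x + t) + f x) / (a b)\<close> at position \<open>(u\<^sub>j, v)\<close> for every column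
  \<open>s = a e\<^sub>u\<close> of \<open>S\<close> and every column \<open>t = b e\<^sub>v\<close> of \<open>T\<^sub>j\<close>, and zeros elsewhere, and the projection
  erases precisely the other positions, all relevant ones having \<open>u\<^sub>j < v\<close>.
  By the mean value theorem each entry is a second derivative at a nearby point, which bounds the
  entrywise error; passing to the Frobenius norm costs \<open>sqrt (m k)\<close>, and the remaining factors of the
  bound are at least 1.  The sample points lie in the open ball because \<open>u\<^sub>j \<noteq> v\<close> makes
  \<open>s\<close> and \<open>t\<close> orthogonal, so \<open>\<parallel>s + t\<parallel> < \<parallel>s\<parallel> + \<parallel>t\<parallel>\<close>.
\<close>

subsection \<open>Norms\<close>

lemma abs_index_le_vnorm:
  assumes "i < dim_vec v"
  shows "\<bar>v $ i\<bar> \<le> vnorm v"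
proof -
  have "(v $ i)\<^sup>2 \<le> (\<Sum>j<dim_vec v. (v $ j)\<^sup>2)"
    using assms by (intro member_le_sum) auto
  then show ?thesis
    unfolding vnorm_def L2_set_def by (simp add: real_le_rsqrt)
qed

lemma vnorm_smult_unit_vec:
  assumes "i < n"
  shows "vnorm (c \<cdot>\<^sub>v unit_vec n i) = \<bar>c\<bar>"
proof -
  have "(\<Sum>j<n. (c * unit_vec n i $ j)\<^sup>2) = (\<Sum>j<n. if j = i then c\<^sup>2 else 0)"
    by (intro sum.cong) (auto simp: unit_vec_def)
  then show ?thesis
    using assms by (simp add: vnorm_def L2_set_def)
qed

lemma vnorm_unit_vec: "i < n \<Longrightarrow> vnorm (unit_vec n i) = 1"
  using vnorm_smult_unit_vec[of i n 1] by simp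

text \<open>Cauchy-Schwarz in each row, summed over the rows.\<close>

lemma vnorm_mult_mat_vec_le:
  assumes "dim_vec v = dim_col A"
  shows "vnorm (A *\<^sub>v v)
    \<le> sqrt (\<Sum>i<dim_row A. \<Sum>j<dim_col A. (A $$ (i, j))\<^sup>2) * vnorm v"
proof -
  have "(\<Sum>i<dim_row A. ((A *\<^sub>v v) $ i)\<^sup>2)
      \<le> (\<Sum>i<dim_row A. (\<Sum>j<dim_col A. (A $$ (i, j))\<^sup>2) * (\<Sum>j<dim_col A. (v $ j)\<^sup>2))"
  proof (rule sum_mono)
    fix i assume "i \<in> {..<dim_row A}"
    then have "(A *\<^sub>v v) $ i = (\<Sum>j<dim_col A. A $$ (i, j) * v $ j)"
      using assms by (simp add: scalar_prod_def atLeast0LessThan)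
    then show "((A *\<^sub>v v) $ i)\<^sup>2
        \<le> (\<Sum>j<dim_col A. (A $$ (i, j))\<^sup>2) * (\<Sum>j<dim_col A. (v $ j)\<^sup>2)"
      using Cauchy_Schwarz_ineq_sum by metis
  qed
  then show ?thesis
    using assms unfolding vnorm_def L2_set_def
    by (simp flip: sum_distrib_right real_sqrt_mult)
qed

lemma vnorm_mult_unit_ball_le_frobenius:
  assumes "v \<in> {v \<in> carrier_vec (dim_col A). vnorm v \<le> 1}"
  shows "vnorm (A *\<^sub>v v) \<le> sqrt (\<Sum>i<dim_row A. \<Sum>j<dim_col A. (A $$ (i, j))\<^sup>2)"
proof -
  have "vnorm (A *\<^sub>v v)
      \<le> sqrt (\<Sum>i<dim_row A. \<Sum>j<dim_col A. (A $$ (i, j))\<^sup>2) * vnorm v"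
    using assms by (intro vnorm_mult_mat_vec_le) auto
  also have "\<dots> \<le> sqrt (\<Sum>i<dim_row A. \<Sum>j<dim_col A. (A $$ (i, j))\<^sup>2) * 1"
    using assms by (intro mult_left_mono) (auto intro!: sum_nonneg)
  finally show ?thesis by simp
qed

lemma mat_norm_le_frobenius:
  "mat_norm A \<le> sqrt (\<Sum>i<dim_row A. \<Sum>j<dim_col A. (A $$ (i, j))\<^sup>2)"
proof -
  \<comment> \<open>The zero vector shows that the supremum ranges over a non-empty set, as
    \<open>cSUP_least\<close> requires.\<close>
  have "0\<^sub>v (dim_col A) \<in> {v \<in> carrier_vec (dim_col A). vnorm v \<le> 1}"
    by (simp add: vnorm_def L2_set_def)
  then show ?thesis
    unfolding mat_norm_def
    by (intro cSUP_least vnorm_mult_unit_ball_le_frobenius) blast+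
qed

text \<open>An entry is a coordinate of the image of a basis vector; the Frobenius bound makes the
  supremum finite. This turns Lipschitz conditions in operator norm into entrywise ones and also
  bounds norms from below.\<close>

lemma abs_entry_le_mat_norm:
  assumes "i < dim_row A" "j < dim_col A"
  shows "\<bar>A $$ (i, j)\<bar> \<le> mat_norm A"
proof -
  have "(A *\<^sub>v unit_vec (dim_col A) j) $ i = A $$ (i, j)"
    using assms by simp
  then have "\<bar>A $$ (i, j)\<bar> \<le> vnorm (A *\<^sub>v unit_vec (dim_col A) j)"
    using abs_index_le_vnorm[of i "A *\<^sub>v unit_vec (dim_col A) j"] assms by simp
  also have "\<dots> \<le> mat_norm A"
    unfolding mat_norm_def
    using assms vnorm_mult_unit_ball_le_frobenius
    by (intro cSUP_upper) (auto simp: vnorm_unit_vec intro!: bdd_aboveI2)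
  finally show ?thesis .
qed

lemma sum_mult_unit_vec:
  fixes h :: "nat \<Rightarrow> real"
  assumes "i < n"
  shows "(\<Sum>x<n. h x * unit_vec n i $ x) = h i"
proof -
  have "(\<Sum>x<n. h x * unit_vec n i $ x) = (\<Sum>x<n. if x = i then h x else 0)"
    using assms by (intro sum.cong) auto
  then show ?thesis using assms by simp
qed

text \<open>Evaluating the form at three basis vectors isolates one coefficient, provided the
  supremum is finite.\<close>

lemma abs_entry_le_trilinear_norm:
  assumes "i < n" "j < n" "l < n"
  shows "\<bar>A i j l\<bar> \<le> trilinear_norm n A"
proof -
  let ?B = "{(u, v, w). u \<in> carrier_vec n \<and> v \<in> carrier_vec n \<and> w \<in> carrier_vec n \<and>
                        vnorm u \<le> 1 \<and> vnorm v \<le> 1 \<and> vnorm w \<le> (1 :: real)}"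
  let ?F = "\<lambda>(u, v, w). \<bar>\<Sum>i<n. \<Sum>j<n. \<Sum>k<n. A i j k * u $ i * v $ j * w $ k\<bar>"
  \<comment> \<open>Coordinates of vectors in the unit ball are at most 1 in modulus, so the sum of
    all \<open>\<bar>A i j k\<bar>\<close> is an upper bound.\<close>
  have bdd: "bdd_above (?F ` ?B)"
  proof (rule bdd_aboveI2)
    fix p assume "p \<in> ?B"
    then obtain u v w where p: "p = (u, v, w)"
      and "u \<in> carrier_vec n" "v \<in> carrier_vec n" "w \<in> carrier_vec n"
      and "vnorm u \<le> 1" "vnorm v \<le> 1" "vnorm w \<le> 1" by blast
    then have le1: "\<bar>u $ i\<bar> \<le> 1" "\<bar>v $ i\<bar> \<le> 1" "\<bar>w $ i\<bar> \<le> 1" if "i < n" for i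
      using that abs_index_le_vnorm[of i u] abs_index_le_vnorm[of i v] abs_index_le_vnorm[of i w]
      by auto
    have "\<bar>A i j k * u $ i * v $ j * w $ k\<bar> \<le> \<bar>A i j k\<bar>" if "i < n" "j < n" "k < n" for i j k
    proof -
      have "\<bar>u $ i\<bar> * \<bar>v $ j\<bar> * \<bar>w $ k\<bar> \<le> 1 * 1 * 1"
        using le1 that by (intro mult_mono) auto
      then have "\<bar>A i j k\<bar> * (\<bar>u $ i\<bar> * \<bar>v $ j\<bar> * \<bar>w $ k\<bar>) \<le> \<bar>A i j k\<bar> * 1"
        by (intro mult_left_mono) auto
      then show ?thesis by (simp add: abs_mult mult.assoc)
    qed
    then have "(\<Sum>i<n. \<Sum>j<n. \<Sum>k<n. \<bar>A i j k * u $ i * v $ j * w $ k\<bar>)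
        \<le> (\<Sum>i<n. \<Sum>j<n. \<Sum>k<n. \<bar>A i j k\<bar>)"
      by (intro sum_mono) auto
    then show "?F p \<le> (\<Sum>i<n. \<Sum>j<n. \<Sum>k<n. \<bar>A i j k\<bar>)"
      unfolding p prod.case
      by (rule order_trans[rotated]) (intro sum_abs[THEN order_trans] sum_mono order_refl)
  qed
  have "(\<Sum>i'<n. \<Sum>j'<n. \<Sum>k'<n. A i' j' k' * unit_vec n i $ i' * unit_vec n j $ j' * unit_vec n l $ k')
      = A i j l"
    by (simp only: sum_mult_unit_vec assms)
  then have "?F (unit_vec n i, unit_vec n j, unit_vec n l) = \<bar>A i j l\<bar>" by simp
  moreover have "(unit_vec n i, unit_vec n j, unit_vec n l) \<in> ?B"
    using assms by (simp add: vnorm_unit_vec)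
  ultimately show ?thesis
    unfolding trilinear_norm_def
    using cSUP_upper[OF _ bdd, of "(unit_vec n i, unit_vec n j, unit_vec n l)"] by simp
qed

subsection \<open>Pseudoinverses\<close>

text \<open>Penrose's argument: \<open>A * X = (A * Y) * (A * X)\<close> is a product of symmetric
  matrices, so transposing reverses it to \<open>(A * X) * (A * Y) = A * Y\<close>. Likewise
  \<open>X * A = Y * A\<close>, and then \<open>X = X * A * X = Y * A * Y = Y\<close>.\<close>

lemma is_pinv_unique:
  assumes X: "is_pinv A X" and Y: "is_pinv A Y"
  shows "X = Y"
proof -
  define r c where "r = dim_row A" and "c = dim_col A"
  have A: "A \<in> carrier_mat r c" and Xc: "X \<in> carrier_mat c r" and Yc: "Y \<in> carrier_mat c r"
    using X Y by (auto simp: is_pinv_def r_def c_def)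
  have AX: "A * X \<in> carrier_mat r r" and AY: "A * Y \<in> carrier_mat r r"
    and XA: "X * A \<in> carrier_mat c c" and YA: "Y * A \<in> carrier_mat c c"
    using A Xc Yc by auto
  have 1: "A * X = A * Y"
  proof -
    have "A * X = (A * Y * A) * X" using Y by (simp add: is_pinv_def)
    also have "\<dots> = (A * Y) * (A * X)" using A Xc AY by (simp add: assoc_mult_mat[of _ r r])
    also have "\<dots> = (A * Y)\<^sup>T * (A * X)\<^sup>T" using X Y by (simp add: is_pinv_def)
    also have "\<dots> = ((A * X) * (A * Y))\<^sup>T" using transpose_mult[OF AX AY] by simp
    also have "(A * X) * (A * Y) = (A * X * A) * Y"
      using A Yc AX by (simp add: assoc_mult_mat[of _ r r])
    also have "\<dots> = A * Y" using X by (simp add: is_pinv_def)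
    also have "(A * Y)\<^sup>T = A * Y" using Y by (simp add: is_pinv_def)
    finally show ?thesis .
  qed
  have 2: "X * A = Y * A"
  proof -
    have "X * A = X * (A * Y * A)" using Y by (simp add: is_pinv_def)
    also have "\<dots> = (X * A) * (Y * A)"
      by (simp add: assoc_mult_mat[OF A Yc A] assoc_mult_mat[OF Xc A YA])
    also have "\<dots> = (X * A)\<^sup>T * (Y * A)\<^sup>T" using X Y by (simp add: is_pinv_def)
    also have "\<dots> = ((Y * A) * (X * A))\<^sup>T" using transpose_mult[OF YA XA] by simp
    also have "(Y * A) * (X * A) = Y * (A * X * A)"
      by (simp add: assoc_mult_mat[OF A Xc A] assoc_mult_mat[OF Yc A XA])
    also have "\<dots> = Y * A" using X by (simp add: is_pinv_def)
    also have "(Y * A)\<^sup>T = Y * A" using Y by (simp add: is_pinv_def)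
    finally show ?thesis .
  qed
  have "X = X * A * X" using X by (simp add: is_pinv_def)
  also have "\<dots> = Y * (A * X)" using 2 A Xc Yc by (simp add: assoc_mult_mat[of _ c r])
  also have "\<dots> = Y * A * Y" using 1 A Yc by (simp add: assoc_mult_mat[of _ c r])
  also have "\<dots> = Y" using Y by (simp add: is_pinv_def)
  finally show ?thesis .
qed

lemma pinv_eqI: "is_pinv A X \<Longrightarrow> pinv A = X"
  unfolding pinv_def by (blast intro: the_equality is_pinv_unique)

text \<open>Transposition preserves the first two Penrose equations and exchanges the two symmetry
  conditions.\<close>

lemma is_pinv_transpose:
  assumes "is_pinv A X"
  shows "is_pinv (A\<^sup>T) (X\<^sup>T)"
proof -
  define r c where "r = dim_row A" and "c = dim_col A"
  have A: "A \<in> carrier_mat r c" and X: "X \<in> carrier_mat c r"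
    using assms by (auto simp: is_pinv_def r_def c_def)
  have AX: "A * X \<in> carrier_mat r r" and XA: "X * A \<in> carrier_mat c c"
    using A X by auto
  note tr = transpose_mult[OF A X] transpose_mult[OF X A]
  have "A\<^sup>T * X\<^sup>T * A\<^sup>T = (A * (X * A))\<^sup>T" "X\<^sup>T * A\<^sup>T * X\<^sup>T = (X * (A * X))\<^sup>T"
    using tr transpose_mult[OF A XA] transpose_mult[OF X AX] by auto
  then have "A\<^sup>T * X\<^sup>T * A\<^sup>T = (A * X * A)\<^sup>T" "X\<^sup>T * A\<^sup>T * X\<^sup>T = (X * A * X)\<^sup>T"
    using A X by auto
  then show ?thesis
    using assms A X unfolding is_pinv_def tr[symmetric] by auto
qed

subsection \<open>Matrices whose columns are multiples of distinct basis vectors\<close>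

text \<open>Common form of \<open>S\<close> and of every \<open>Ts j\<close>. Negation,
  normalization and, up to a transpose, pseudoinversion only change the weights
  \<open>a\<close>.\<close>

definition sel_mat :: "nat \<Rightarrow> nat \<Rightarrow> (nat \<Rightarrow> nat) \<Rightarrow> (nat \<Rightarrow> real) \<Rightarrow> real mat" where
  "sel_mat n m p a = mat n m (\<lambda>(i, j). if i = p j then a j else 0)"

lemma sel_mat_carrier[simp]: "sel_mat n m p a \<in> carrier_mat n m"
  by (simp add: sel_mat_def)

lemma dim_sel_mat[simp]: "dim_row (sel_mat n m p a) = n" "dim_col (sel_mat n m p a) = m"
  by (simp_all add: sel_mat_def)

lemma index_sel_mat[simp]:
  "i < n \<Longrightarrow> j < m \<Longrightarrow> sel_mat n m p a $$ (i, j) = (if i = p j then a j else 0)"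
  by (simp add: sel_mat_def)

lemma col_sel_mat: "j < m \<Longrightarrow> col (sel_mat n m p a) j = a j \<cdot>\<^sub>v unit_vec n (p j)"
  by (rule eq_vecI) (auto simp: unit_vec_def)

lemma uminus_sel_mat: "- sel_mat n m p a = sel_mat n m p (\<lambda>j. - a j)"
  by (rule eq_matI) auto

lemma normalized_sel_mat:
  "normalized (sel_mat n m p a) = sel_mat n m p (\<lambda>j. a j / radius (sel_mat n m p a))"
  unfolding normalized_def by (rule eq_matI) auto

lemma index_mult_mat_sum:
  assumes "A \<in> carrier_mat n m" "B \<in> carrier_mat m q" "i < n" "j < q"
  shows "(A * B) $$ (i, j) = (\<Sum>l<m. A $$ (i, l) * B $$ (l, j))"
  using assms by (simp add: scalar_prod_def atLeast0LessThan)

text \<open>The columns are non-zero and mutually orthogonal, so inverting the weights gives a left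
  inverse; the product in the other order is the coordinate projection onto the positions
  \<open>p j\<close>.\<close>

lemma is_pinv_sel_mat:
  assumes inj: "inj_on p {..<m}" and p: "\<And>j. j < m \<Longrightarrow> p j < n"
    and a: "\<And>j. j < m \<Longrightarrow> a j \<noteq> 0"
  shows "is_pinv (sel_mat n m p a) ((sel_mat n m p (\<lambda>j. 1 / a j))\<^sup>T)"
proof -
  let ?A = "sel_mat n m p a" and ?B = "sel_mat n m p (\<lambda>j. 1 / a j)"
  have BA: "?B\<^sup>T * ?A = 1\<^sub>m m"
  proof (rule eq_matI)
    fix i j assume "i < dim_row (1\<^sub>m m :: real mat)" "j < dim_col (1\<^sub>m m :: real mat)"
    then have ij: "i < m" "j < m" by auto
    then have "(?B\<^sup>T * ?A) $$ (i, j) = (\<Sum>l<n. ?B\<^sup>T $$ (i, l) * ?A $$ (l, j))"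
      by (intro index_mult_mat_sum[of _ m]) auto
    also have "\<dots> = (\<Sum>l<n. if l = p i then (if p i = p j then a j / a i else 0) else 0)"
      using ij by (intro sum.cong) auto
    also have "\<dots> = (if i = j then 1 else 0)"
      using ij p a inj by (auto dest: inj_onD)
    finally show "(?B\<^sup>T * ?A) $$ (i, j) = 1\<^sub>m m $$ (i, j)" using ij by simp
  qed auto
  \<comment> \<open>The weights cancel, and the remaining expression is visibly symmetric in
    \<open>x\<close> and \<open>y\<close>.\<close>
  have AB: "?A * ?B\<^sup>T
      = mat n n (\<lambda>(x, y). \<Sum>l<m. if x = p l \<and> y = p l then 1 else 0)"
  proof (rule eq_matI)
    fix x y
    assume "x < dim_row (mat n n (\<lambda>(x, y). \<Sum>l<m. if x = p l \<and> y = p l then 1 :: real else 0))"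
      "y < dim_col (mat n n (\<lambda>(x, y). \<Sum>l<m. if x = p l \<and> y = p l then 1 :: real else 0))"
    then have xy: "x < n" "y < n" by auto
    then have "(?A * ?B\<^sup>T) $$ (x, y) = (\<Sum>l<m. ?A $$ (x, l) * ?B\<^sup>T $$ (l, y))"
      by (intro index_mult_mat_sum[of _ n]) auto
    also have "\<dots> = (\<Sum>l<m. if x = p l \<and> y = p l then 1 else 0)"
      using xy a by (intro sum.cong) auto
    finally show "(?A * ?B\<^sup>T) $$ (x, y)
        = mat n n (\<lambda>(x, y). \<Sum>l<m. if x = p l \<and> y = p l then 1 else 0) $$ (x, y)"
      using xy by simp
  qed auto
  have A: "?A \<in> carrier_mat n m" and Bt: "?B\<^sup>T \<in> carrier_mat m n" by auto
  have "?A * ?B\<^sup>T * ?A = ?A"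
    unfolding assoc_mult_mat[OF A Bt A] BA by simp
  moreover have "?B\<^sup>T * ?A * ?B\<^sup>T = ?B\<^sup>T"
    unfolding BA using Bt by simp
  moreover have "(?A * ?B\<^sup>T)\<^sup>T = ?A * ?B\<^sup>T"
    unfolding AB by (rule eq_matI) (auto intro!: sum.cong)
  ultimately show ?thesis
    unfolding is_pinv_def BA by auto
qed

lemma pinv_sel_mat:
  assumes "inj_on p {..<m}" "\<And>j. j < m \<Longrightarrow> p j < n" "\<And>j. j < m \<Longrightarrow> a j \<noteq> 0"
  shows "pinv (sel_mat n m p a) = (sel_mat n m p (\<lambda>j. 1 / a j))\<^sup>T"
    and "pinv ((sel_mat n m p a)\<^sup>T) = sel_mat n m p (\<lambda>j. 1 / a j)"
  using pinv_eqI[OF is_pinv_sel_mat[OF assms]]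
    pinv_eqI[OF is_pinv_transpose[OF is_pinv_sel_mat[OF assms]]] by simp_all

lemma abs_le_radius_sel_mat:
  assumes "j < m" "p j < n"
  shows "\<bar>a j\<bar> \<le> radius (sel_mat n m p a)"
proof -
  have "vnorm (col (sel_mat n m p a) j) \<le> radius (sel_mat n m p a)"
    unfolding radius_def using assms by (intro Max_ge) auto
  then show ?thesis using assms by (simp add: col_sel_mat vnorm_smult_unit_vec)
qed

text \<open>Normalized weights are at most 1 in modulus, so the pseudoinverse, whose weights are
  their reciprocals, has an entry of modulus at least 1. Hence these factors can only enlarge an
  error bound.\<close>

lemma mat_norm_pinv_normalized_sel_mat:
  assumes "inj_on p {..<m}" and p: "\<And>j. j < m \<Longrightarrow> p j < n" and a: "\<And>j. j < m \<Longrightarrow> a j \<noteq> 0"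
    and m: "0 < m"
  shows "1 \<le> mat_norm (pinv (normalized (sel_mat n m p a)))"
    and "1 \<le> mat_norm (pinv ((normalized (sel_mat n m p a))\<^sup>T))"
proof -
  let ?r = "radius (sel_mat n m p a)"
  have r: "\<bar>a 0\<bar> \<le> ?r" using m p by (intro abs_le_radius_sel_mat) auto
  then have r0: "?r > 0" using a[OF m] by auto
  have "1 \<le> \<bar>1 / (a 0 / ?r)\<bar>"
    using r r0 a[OF m] by (simp add: field_simps)
  then have le: "1 \<le> \<bar>sel_mat n m p (\<lambda>j. 1 / (a j / ?r)) $$ (p 0, 0)\<bar>"
    using m p by simp
  have "1 \<le> mat_norm ((sel_mat n m p (\<lambda>j. 1 / (a j / ?r)))\<^sup>T)"
    using le abs_entry_le_mat_norm[of 0 "(sel_mat n m p (\<lambda>j. 1 / (a j / ?r)))\<^sup>T" "p 0"] m p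
    by auto
  moreover have "1 \<le> mat_norm (sel_mat n m p (\<lambda>j. 1 / (a j / ?r)))"
    using le abs_entry_le_mat_norm[of "p 0" "sel_mat n m p (\<lambda>j. 1 / (a j / ?r))" 0] m p
    by auto
  moreover have "a j / ?r \<noteq> 0" if "j < m" for j using a[OF that] r0 by simp
  ultimately show "1 \<le> mat_norm (pinv (normalized (sel_mat n m p a)))"
    and "1 \<le> mat_norm (pinv ((normalized (sel_mat n m p a))\<^sup>T))"
    unfolding normalized_sel_mat using pinv_sel_mat[OF assms(1) p, where a = "\<lambda>j. a j / ?r"]
    by simp_all
qed

subsection \<open>Mean value estimates in two real variables\<close>

text \<open>The diagonal entries serving as step lengths may have either sign; a symmetric interval
  treats both at once.\<close>

lemma mvt_signed:
  fixes g g' :: "real \<Rightarrow> real"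
  assumes "\<And>t. \<bar>t\<bar> \<le> \<bar>b\<bar> \<Longrightarrow> (g has_real_derivative g' t) (at t)"
  shows "\<exists>t. \<bar>t\<bar> \<le> \<bar>b\<bar> \<and> g b - g 0 = b * g' t"
proof -
  consider "b = 0" | "b > 0" | "b < 0" by linarith
  then show ?thesis
  proof cases
    case 1
    then show ?thesis by auto
  next
    case 2
    then have "\<exists>z. 0 < z \<and> z < b \<and> g b - g 0 = (b - 0) * g' z"
      using assms by (intro MVT2) auto
    then show ?thesis by force
  next
    case 3
    then have "\<exists>z. b < z \<and> z < 0 \<and> g 0 - g b = (0 - b) * g' z"
      using assms by (intro MVT2) auto
    then obtain z where "b < z" "z < 0" "g 0 - g b = (0 - b) * g' z" by blast
    then show ?thesis by (intro exI[of _ z]) (auto simp: algebra_simps)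
  qed
qed

text \<open>The mean value theorem is used twice: in \<open>t\<close> for the difference of the
  slices \<open>s = a\<close> and \<open>s = 0\<close>, then in \<open>s\<close> for
  \<open>Fv\<close> at the value of \<open>t\<close> just found.\<close>

lemma mixed_difference_mvt:
  fixes F Fv Fuv :: "real \<Rightarrow> real \<Rightarrow> real"
  assumes Fv: "\<And>s t. \<bar>s\<bar> \<le> \<bar>a\<bar> \<Longrightarrow> \<bar>t\<bar> \<le> \<bar>b\<bar> \<Longrightarrow> (F s has_real_derivative Fv s t) (at t)"
    and Fuv: "\<And>s t. \<bar>s\<bar> \<le> \<bar>a\<bar> \<Longrightarrow> \<bar>t\<bar> \<le> \<bar>b\<bar> \<Longrightarrow>
      ((\<lambda>s. Fv s t) has_real_derivative Fuv s t) (at s)"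
  shows "\<exists>s t. \<bar>s\<bar> \<le> \<bar>a\<bar> \<and> \<bar>t\<bar> \<le> \<bar>b\<bar> \<and> F a b - F a 0 - (F 0 b - F 0 0) = a * b * Fuv s t"
proof -
  have "\<exists>t. \<bar>t\<bar> \<le> \<bar>b\<bar> \<and> (F a b - F 0 b) - (F a 0 - F 0 0) = b * (Fv a t - Fv 0 t)"
    using Fv by (intro mvt_signed DERIV_diff) auto
  then obtain t where t: "\<bar>t\<bar> \<le> \<bar>b\<bar>" "(F a b - F 0 b) - (F a 0 - F 0 0) = b * (Fv a t - Fv 0 t)"
    by blast
  have "\<exists>s. \<bar>s\<bar> \<le> \<bar>a\<bar> \<and> Fv a t - Fv 0 t = a * Fuv s t"
    using Fuv t by (intro mvt_signed) auto
  then obtain s where "\<bar>s\<bar> \<le> \<bar>a\<bar>" "Fv a t - Fv 0 t = a * Fuv s t"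
    by blast
  moreover from this t have "F a b - F a 0 - (F 0 b - F 0 0) = a * b * Fuv s t"
    by (simp add: algebra_simps)
  ultimately show ?thesis using t by blast
qed

lemma increment_le_quadratic:
  fixes g g' :: "real \<Rightarrow> real"
  assumes g: "\<And>t. \<bar>t\<bar> \<le> \<bar>b\<bar> \<Longrightarrow> (g has_real_derivative g' t) (at t)"
    and le: "\<And>t. \<bar>t\<bar> \<le> \<bar>b\<bar> \<Longrightarrow> g' t * sgn b \<le> c + d * \<bar>t\<bar>"
  shows "g b - g 0 \<le> c * \<bar>b\<bar> + d * b\<^sup>2 / 2"
proof -
  \<comment> \<open>On the segment \<open>\<tau> * b\<close> the derivative is bounded by
    \<open>(c + d * \<bar>\<tau> * b\<bar>) * \<bar>b\<bar>\<close>; the subtracted polynomial is an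
    antiderivative of this bound, so \<open>h\<close> cannot increase.\<close>
  define h where "h \<tau> = g (\<tau> * b) - (c * \<bar>b\<bar> * \<tau> + d * b\<^sup>2 * \<tau>\<^sup>2 / 2)" for \<tau>
  have "h 1 \<le> h 0"
  proof (rule DERIV_nonpos_imp_nonincreasing[where f = h and a = 0 and b = 1])
    fix \<tau> :: real assume \<tau>: "0 \<le> \<tau>" "\<tau> \<le> 1"
    then have t: "\<bar>\<tau> * b\<bar> \<le> \<bar>b\<bar>" by (simp add: abs_mult mult_left_le_one_le)
    have "((\<lambda>\<tau>. g (\<tau> * b)) has_real_derivative g' (\<tau> * b) * b) (at \<tau>)"
      by (rule DERIV_chain2[where f = g and g = "\<lambda>\<tau>. \<tau> * b", OF g[OF t]]) (auto intro!: derivative_eq_intros)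
    then have "(h has_real_derivative g' (\<tau> * b) * b - (c * \<bar>b\<bar> + d * b\<^sup>2 * \<tau>)) (at \<tau>)"
      unfolding h_def by (auto intro!: derivative_eq_intros)
    moreover have "g' (\<tau> * b) * b \<le> c * \<bar>b\<bar> + d * b\<^sup>2 * \<tau>"
    proof -
      have "g' (\<tau> * b) * b = (g' (\<tau> * b) * sgn b) * \<bar>b\<bar>"
        by (metis mult.assoc mult_sgn_abs)
      also have "\<dots> \<le> (c + d * \<bar>\<tau> * b\<bar>) * \<bar>b\<bar>"
        using le[OF t] by (intro mult_right_mono) auto
      also have "\<dots> = c * \<bar>b\<bar> + d * b\<^sup>2 * \<tau>"
        using \<tau> by (simp add: abs_mult algebra_simps power2_eq_square)
      finally show ?thesis .
    qed
    ultimately show "\<exists>y. (h has_real_derivative y) (at \<tau>) \<and> y \<le> 0" by force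
  qed simp
  then show ?thesis by (simp add: h_def)
qed

lemma abs_increment_le_quadratic:
  fixes g g' :: "real \<Rightarrow> real"
  assumes g: "\<And>t. \<bar>t\<bar> \<le> \<bar>b\<bar> \<Longrightarrow> (g has_real_derivative g' t) (at t)"
    and le: "\<And>t. \<bar>t\<bar> \<le> \<bar>b\<bar> \<Longrightarrow> \<bar>g' t\<bar> \<le> c + d * \<bar>t\<bar>"
  shows "\<bar>g b - g 0\<bar> \<le> c * \<bar>b\<bar> + d * b\<^sup>2 / 2"
proof -
  have sgn: "\<bar>g' t * sgn b\<bar> \<le> c + d * \<bar>t\<bar>" if "\<bar>t\<bar> \<le> \<bar>b\<bar>" for t
    using le[OF that] by (auto simp: sgn_if)
  have "g b - g 0 \<le> c * \<bar>b\<bar> + d * b\<^sup>2 / 2"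
    using g sgn by (intro increment_le_quadratic) (auto simp: abs_le_iff)
  moreover have "- g b - (- g 0) \<le> c * \<bar>b\<bar> + d * b\<^sup>2 / 2"
    using g sgn by (intro increment_le_quadratic[where g' = "\<lambda>t. - g' t"])
      (auto simp: abs_le_iff intro: DERIV_minus)
  ultimately show ?thesis by linarith
qed

text \<open>Differentiating a symmetric sum yields a difference of derivatives at reflected points,
  which a Lipschitz condition controls. A separate \<open>h\<close> is allowed because the other
  coordinate is reflected too.\<close>

lemma DERIV_even_part:
  fixes g :: "real \<Rightarrow> real"
  assumes "(g has_real_derivative d) (at t)" "(h has_real_derivative e) (at (- t))"
  shows "((\<lambda>t. g t + h (- t)) has_real_derivative d - e) (at t)"
proof -
  have "((\<lambda>t. h (- t)) has_real_derivative - e) (at t)"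
    using assms(2) DERIV_mirror by blast
  then show ?thesis using DERIV_add[OF assms(1)] by fastforce
qed

text \<open>The point moves from the origin to \<open>(a, 0)\<close> and on to
  \<open>(a, b)\<close>, with its reflection moving oppositely. The two legs contribute
  \<open>L * a\<^sup>2\<close> and
  \<open>2 * L * \<bar>a\<bar> * \<bar>b\<bar> + L * b\<^sup>2\<close>, which add up to the
  square.\<close>

lemma symmetric_second_difference_le:
  fixes g gu gv :: "real \<Rightarrow> real \<Rightarrow> real"
  assumes gu: "\<And>s t. \<bar>s\<bar> \<le> \<bar>a\<bar> \<Longrightarrow> \<bar>t\<bar> \<le> \<bar>b\<bar> \<Longrightarrow> ((\<lambda>s. g s t) has_real_derivative gu s t) (at s)"
    and gv: "\<And>s t. \<bar>s\<bar> \<le> \<bar>a\<bar> \<Longrightarrow> \<bar>t\<bar> \<le> \<bar>b\<bar> \<Longrightarrow> (g s has_real_derivative gv s t) (at t)"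
    and Lu: "\<And>s t. \<bar>s\<bar> \<le> \<bar>a\<bar> \<Longrightarrow> \<bar>t\<bar> \<le> \<bar>b\<bar> \<Longrightarrow> \<bar>gu s t - gu (- s) (- t)\<bar> \<le> 2 * L * (\<bar>s\<bar> + \<bar>t\<bar>)"
    and Lv: "\<And>s t. \<bar>s\<bar> \<le> \<bar>a\<bar> \<Longrightarrow> \<bar>t\<bar> \<le> \<bar>b\<bar> \<Longrightarrow> \<bar>gv s t - gv (- s) (- t)\<bar> \<le> 2 * L * (\<bar>s\<bar> + \<bar>t\<bar>)"
  shows "\<bar>g a b + g (- a) (- b) - 2 * g 0 0\<bar> \<le> L * (\<bar>a\<bar> + \<bar>b\<bar>)\<^sup>2"
proof -
  have "\<bar>(g a 0 + g (- a) 0) - (g 0 0 + g (- 0) 0)\<bar> \<le> 0 * \<bar>a\<bar> + 2 * L * a\<^sup>2 / 2"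
    using gu[of _ 0] Lu[of _ 0]
    by (intro abs_increment_le_quadratic[where g' = "\<lambda>s. gu s 0 - gu (- s) 0"] DERIV_even_part) auto
  moreover have "\<bar>(g a b + g (- a) (- b)) - (g a 0 + g (- a) (- 0))\<bar>
      \<le> (2 * L * \<bar>a\<bar>) * \<bar>b\<bar> + 2 * L * b\<^sup>2 / 2"
    using gv[of a] gv[of "- a"] Lv[of a]
    by (intro abs_increment_le_quadratic[where g' = "\<lambda>t. gv a t - gv (- a) (- t)"] DERIV_even_part)
      (auto simp: algebra_simps)
  ultimately have "\<bar>g a b + g (- a) (- b) - 2 * g 0 0\<bar>
      \<le> L * a\<^sup>2 + (2 * L * \<bar>a\<bar>) * \<bar>b\<bar> + L * b\<^sup>2"
    by simp
  also have "\<dots> = L * (\<bar>a\<bar> + \<bar>b\<bar>)\<^sup>2" by (simp add: power2_sum algebra_simps)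
  finally show ?thesis .
qed

subsection \<open>Restriction to coordinate planes\<close>

text \<open>Curried in the two parameters, so that the two-variable estimates apply to
  \<open>f\<close> along the plane.\<close>

definition plane :: "nat \<Rightarrow> real vec \<Rightarrow> nat \<Rightarrow> nat \<Rightarrow> real \<Rightarrow> real \<Rightarrow> real vec" where
  "plane n x u v s t = x + s \<cdot>\<^sub>v unit_vec n u + t \<cdot>\<^sub>v unit_vec n v"

lemma plane_carrier[simp]: "x \<in> carrier_vec n \<Longrightarrow> plane n x u v s t \<in> carrier_vec n"
  by (simp add: plane_def)

lemma plane_zero:
  assumes "x \<in> carrier_vec n"
  shows "plane n x u v s 0 = x + s \<cdot>\<^sub>v unit_vec n u"
    and "plane n x u v 0 t = x + t \<cdot>\<^sub>v unit_vec n v"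
    and "plane n x u v 0 0 = x"
  using assms by (auto simp: plane_def intro!: eq_vecI)

lemma vnorm_plane_diff:
  assumes x: "x \<in> carrier_vec n" and "u < n" "v < n" "u \<noteq> v"
  shows "vnorm (plane n x u v s t - plane n x u v s' t') = sqrt ((s - s')\<^sup>2 + (t - t')\<^sup>2)"
proof -
  have "(\<Sum>i<n. ((plane n x u v s t - plane n x u v s' t') $ i)\<^sup>2)
      = (\<Sum>i<n. (if i = u then (s - s')\<^sup>2 else 0) + (if i = v then (t - t')\<^sup>2 else 0))"
    using assms by (intro sum.cong) (auto simp: plane_def unit_vec_def)
  also have "\<dots> = (s - s')\<^sup>2 + (t - t')\<^sup>2"
    using assms by (simp add: sum.distrib)
  finally show ?thesis
    using x by (simp add: vnorm_def L2_set_def plane_def)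
qed

lemma vnorm_plane_diff_le:
  assumes "x \<in> carrier_vec n" "u < n" "v < n" "u \<noteq> v"
  shows "vnorm (plane n x u v s t - plane n x u v s' t') \<le> \<bar>s - s'\<bar> + \<bar>t - t'\<bar>"
  unfolding vnorm_plane_diff[OF assms] by (rule sqrt_sum_squares_le_sum_abs)

text \<open>\<open>partial_deriv\<close> differentiates only at parameter 0; moving the base point
  along the line reaches every other parameter.\<close>

lemma has_real_derivative_coord_line:
  assumes x: "x \<in> carrier_vec n"
    and "coord_line n i f (x + t \<cdot>\<^sub>v unit_vec n i) field_differentiable at 0"
  shows "(coord_line n i f x has_real_derivative
           partial_deriv n i f (x + t \<cdot>\<^sub>v unit_vec n i)) (at t)"
proof -
  have "coord_line n i f (x + t \<cdot>\<^sub>v unit_vec n i) = (\<lambda>h. coord_line n i f x (h + t))"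
    unfolding coord_line_def using x
    by (auto intro!: ext arg_cong[where f = f] eq_vecI simp: algebra_simps)
  then have "((\<lambda>h. coord_line n i f x (h + t)) has_real_derivative
      partial_deriv n i f (x + t \<cdot>\<^sub>v unit_vec n i)) (at 0)"
    using assms(2) DERIV_deriv_iff_field_differentiable unfolding partial_deriv_def by metis
  then show ?thesis
    using DERIV_shift[of "coord_line n i f x" _ 0 t] by simp
qed

lemma has_real_derivative_plane:
  assumes x: "x \<in> carrier_vec n" and P: "plane n x u v s t \<in> X"
  shows "\<forall>x\<in>X. coord_line n v f x field_differentiable at 0 \<Longrightarrow>
      ((\<lambda>t. f (plane n x u v s t)) has_real_derivative partial_deriv n v f (plane n x u v s t)) (at t)"
    and "\<forall>x\<in>X. coord_line n u f x field_differentiable at 0 \<Longrightarrow>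
      ((\<lambda>s. f (plane n x u v s t)) has_real_derivative partial_deriv n u f (plane n x u v s t)) (at s)"
proof -
  assume "\<forall>x\<in>X. coord_line n v f x field_differentiable at 0"
  then show "((\<lambda>t. f (plane n x u v s t)) has_real_derivative
      partial_deriv n v f (plane n x u v s t)) (at t)"
    using has_real_derivative_coord_line[of "x + s \<cdot>\<^sub>v unit_vec n u" n v f t] x P
    unfolding plane_def coord_line_def by auto
next
  \<comment> \<open>Exchanging the summands puts the varying direction last, the shape of
    \<open>coord_line\<close>.\<close>
  have comm: "plane n x u v s t = x + t \<cdot>\<^sub>v unit_vec n v + s \<cdot>\<^sub>v unit_vec n u" for s t
    using x by (auto simp: plane_def intro!: eq_vecI)
  assume "\<forall>x\<in>X. coord_line n u f x field_differentiable at 0"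
  then show "((\<lambda>s. f (plane n x u v s t)) has_real_derivative
      partial_deriv n u f (plane n x u v s t)) (at s)"
    using has_real_derivative_coord_line[of "x + t \<cdot>\<^sub>v unit_vec n v" n u f s] x P
    unfolding comm coord_line_def by auto
qed

section \<open>Mixed difference quotients and their errors\<close>

text \<open>Discrete counterpart of the second partial derivative in directions \<open>u\<close> and
  \<open>v\<close>; signed steps cover \<open>- S\<close> and \<open>- Ts j\<close> as well.\<close>

definition mixed_quotient ::
  "nat \<Rightarrow> (real vec \<Rightarrow> real) \<Rightarrow> real vec \<Rightarrow> nat \<Rightarrow> nat \<Rightarrow> real \<Rightarrow> real \<Rightarrow> real" where
  "mixed_quotient n f x u v s t =
     (f (plane n x u v s t) - f (plane n x u v s 0)
       - (f (plane n x u v 0 t) - f (plane n x u v 0 0))) / (s * t)"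

lemma mixed_quotient_eq:
  assumes x: "x \<in> carrier_vec n"
  shows "mixed_quotient n f x u v s t =
    (f (x + s \<cdot>\<^sub>v unit_vec n u + t \<cdot>\<^sub>v unit_vec n v) - f (x + s \<cdot>\<^sub>v unit_vec n u)
      - (f (x + t \<cdot>\<^sub>v unit_vec n v) - f x)) / (s * t)"
  unfolding mixed_quotient_def plane_zero(3)[OF x]
  by (simp only: plane_zero(1,2)[OF x] plane_def[of n x u v s t])

text \<open>The quotient equals a second partial derivative at some point of the rectangle, so its
  error is the variation of a Hessian entry over a distance of at most
  \<open>\<bar>a\<bar> + \<bar>b\<bar>\<close>.\<close>

lemma mixed_quotient_error:
  assumes x: "x \<in> carrier_vec n" and uv: "u < n" "v < n" "u \<noteq> v"
    and ab: "a \<noteq> 0" "b \<noteq> 0"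
    and P: "\<And>s t. \<bar>s\<bar> \<le> \<bar>a\<bar> \<Longrightarrow> \<bar>t\<bar> \<le> \<bar>b\<bar> \<Longrightarrow> plane n x u v s t \<in> X"
    and f: "C_k_on n 2 X f" and L: "hessian_lipschitz n L X f" "0 \<le> L"
  shows "\<bar>mixed_quotient n f x u v a b - hessian n f x $$ (u, v)\<bar> \<le> L * (\<bar>a\<bar> + \<bar>b\<bar>)"
proof -
  let ?P = "plane n x u v"
  let ?fv = "partial_deriv n v f"
  let ?fuv = "partial_deriv n u ?fv"
  have d1: "\<forall>x\<in>X. coord_line n v f x field_differentiable at 0"
    and d2: "\<forall>x\<in>X. coord_line n u ?fv x field_differentiable at 0"
    using f uv by (auto simp: numeral_2_eq_2)
  have "\<exists>s t. \<bar>s\<bar> \<le> \<bar>a\<bar> \<and> \<bar>t\<bar> \<le> \<bar>b\<bar> \<and>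
      f (?P a b) - f (?P a 0) - (f (?P 0 b) - f (?P 0 0)) = a * b * ?fuv (?P s t)"
    \<comment> \<open>Differentiating in \<open>v\<close> first and in \<open>u\<close> second
      matches the order in \<open>hessian\<close> at the entry \<open>(u, v)\<close>.\<close>
    by (rule mixed_difference_mvt[where F = "\<lambda>s t. f (?P s t)" and Fv = "\<lambda>s t. ?fv (?P s t)"])
      (auto intro!: has_real_derivative_plane[OF x P] d1 d2)
  then obtain s t where st: "\<bar>s\<bar> \<le> \<bar>a\<bar>" "\<bar>t\<bar> \<le> \<bar>b\<bar>"
    and "mixed_quotient n f x u v a b = ?fuv (?P s t)"
    using ab by (auto simp: mixed_quotient_def)
  then have "\<bar>mixed_quotient n f x u v a b - hessian n f x $$ (u, v)\<bar>
      = \<bar>(hessian n f (?P s t) - hessian n f (?P 0 0)) $$ (u, v)\<bar>"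
    using uv x by (simp add: hessian_def plane_zero(3))
  also have "\<dots> \<le> mat_norm (hessian n f (?P s t) - hessian n f (?P 0 0))"
    using uv by (intro abs_entry_le_mat_norm) (auto simp: hessian_def)
  also have "\<dots> \<le> L * vnorm (?P s t - ?P 0 0)"
    using L P[OF st] P[of 0 0] unfolding hessian_lipschitz_def by auto
  also have "\<dots> \<le> L * (\<bar>s - 0\<bar> + \<bar>t - 0\<bar>)"
    using L by (intro mult_left_mono vnorm_plane_diff_le x uv) auto
  also have "\<dots> \<le> L * (\<bar>a\<bar> + \<bar>b\<bar>)"
    using L st by (intro mult_left_mono) auto
  finally show ?thesis .
qed

text \<open>The mean value theorem is applied to \<open>p \<mapsto> f (x + p) + f (x - p)\<close>, so that the second
  derivative is evaluated at two points symmetric about \<open>x\<close> and its first-order errors cancel.\<close>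

lemma centered_mixed_quotient_error:
  assumes x: "x \<in> carrier_vec n" and uv: "u < n" "v < n" "u \<noteq> v"
    and ab: "a \<noteq> 0" "b \<noteq> 0"
    and P: "\<And>s t. \<bar>s\<bar> \<le> \<bar>a\<bar> \<Longrightarrow> \<bar>t\<bar> \<le> \<bar>b\<bar> \<Longrightarrow> plane n x u v s t \<in> X"
    and f: "C_k_on n 3 X f" and L: "third_deriv_lipschitz n L X f" "0 \<le> L"
  shows "\<bar>(mixed_quotient n f x u v a b + mixed_quotient n f x u v (- a) (- b)) / 2
      - hessian n f x $$ (u, v)\<bar> \<le> L * (\<bar>a\<bar> + \<bar>b\<bar>)\<^sup>2 / 2"
proof -
  let ?P = "plane n x u v"
  let ?fv = "partial_deriv n v f"
  let ?fuv = "partial_deriv n u ?fv"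
  have d1: "\<forall>x\<in>X. coord_line n v f x field_differentiable at 0"
    and d2: "\<forall>x\<in>X. coord_line n u ?fv x field_differentiable at 0"
    and d3: "\<And>w. w < n \<Longrightarrow> \<forall>x\<in>X. coord_line n w ?fuv x field_differentiable at 0"
    using f uv by (auto simp: numeral_3_eq_3)
  \<comment> \<open>The reflected points differ by \<open>2 * s\<close> and \<open>2 * t\<close> in
    the two directions, whence the factor 2.\<close>
  have Lip: "\<bar>partial_deriv n w ?fuv (?P s t) - partial_deriv n w ?fuv (?P (- s) (- t))\<bar>
      \<le> 2 * L * (\<bar>s\<bar> + \<bar>t\<bar>)" if "w < n" "\<bar>s\<bar> \<le> \<bar>a\<bar>" "\<bar>t\<bar> \<le> \<bar>b\<bar>" for w s t
  proof -
    let ?A = "\<lambda>i j k. third_deriv n f (?P s t) i j k - third_deriv n f (?P (- s) (- t)) i j k"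
    have "\<bar>?A w u v\<bar> \<le> trilinear_norm n ?A"
      using that uv by (intro abs_entry_le_trilinear_norm)
    also have "\<dots> \<le> L * vnorm (?P s t - ?P (- s) (- t))"
      using L P that unfolding third_deriv_lipschitz_def by auto
    also have "\<dots> \<le> L * (\<bar>s - (- s)\<bar> + \<bar>t - (- t)\<bar>)"
      using L by (intro mult_left_mono vnorm_plane_diff_le x uv) auto
    also have "\<dots> = 2 * L * (\<bar>s\<bar> + \<bar>t\<bar>)" by (simp add: algebra_simps abs_if)
    finally show ?thesis by (simp add: third_deriv_def)
  qed
  let ?F = "\<lambda>s t. f (?P s t) + f (?P (- s) (- t))"
  have "\<exists>s t. \<bar>s\<bar> \<le> \<bar>a\<bar> \<and> \<bar>t\<bar> \<le> \<bar>b\<bar> \<and>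
      ?F a b - ?F a 0 - (?F 0 b - ?F 0 0) = a * b * (?fuv (?P s t) + ?fuv (?P (- s) (- t)))"
  proof (rule mixed_difference_mvt[where F = ?F and Fv = "\<lambda>s t. ?fv (?P s t) - ?fv (?P (- s) (- t))"])
    fix s t :: real assume st: "\<bar>s\<bar> \<le> \<bar>a\<bar>" "\<bar>t\<bar> \<le> \<bar>b\<bar>"
    show "(?F s has_real_derivative ?fv (?P s t) - ?fv (?P (- s) (- t))) (at t)"
      using st by (intro DERIV_even_part has_real_derivative_plane[OF x P] d1) auto
    \<comment> \<open>The second reflection restores the plus sign: the symmetric sum in
      \<open>f\<close> becomes a symmetric sum in \<open>?fuv\<close>.\<close>
    have "((\<lambda>s. ?fv (?P s t) + - ?fv (?P (- s) (- t))) has_real_derivative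
        ?fuv (?P s t) - - ?fuv (?P (- s) (- t))) (at s)"
      using st by (intro DERIV_even_part DERIV_minus has_real_derivative_plane[OF x P] d2) auto
    then show "((\<lambda>s. ?fv (?P s t) - ?fv (?P (- s) (- t))) has_real_derivative
        ?fuv (?P s t) + ?fuv (?P (- s) (- t))) (at s)" by simp
  qed
  then obtain s t where st: "\<bar>s\<bar> \<le> \<bar>a\<bar>" "\<bar>t\<bar> \<le> \<bar>b\<bar>"
    and eq: "?F a b - ?F a 0 - (?F 0 b - ?F 0 0)
      = a * b * (?fuv (?P s t) + ?fuv (?P (- s) (- t)))" by blast
  \<comment> \<open>Both quotients have the denominator \<open>a * b\<close>, since the two signs
    cancel in the second one.\<close>
  have "mixed_quotient n f x u v a b + mixed_quotient n f x u v (- a) (- b)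
      = (?F a b - ?F a 0 - (?F 0 b - ?F 0 0)) / (a * b)"
    using ab by (simp add: mixed_quotient_def field_simps)
  then have *: "(mixed_quotient n f x u v a b + mixed_quotient n f x u v (- a) (- b)) / 2
      - hessian n f x $$ (u, v)
      = (?fuv (?P s t) + ?fuv (?P (- s) (- t)) - 2 * ?fuv (?P 0 0)) / 2"
    unfolding eq using ab uv x by (simp add: hessian_def plane_zero(3))
  have "\<bar>?fuv (?P s t) + ?fuv (?P (- s) (- t)) - 2 * ?fuv (?P 0 0)\<bar>
      \<le> L * (\<bar>s\<bar> + \<bar>t\<bar>)\<^sup>2"
    using st uv
    by (intro symmetric_second_difference_le[where g = "\<lambda>s t. ?fuv (?P s t)"
          and gu = "\<lambda>s t. partial_deriv n u ?fuv (?P s t)"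
          and gv = "\<lambda>s t. partial_deriv n v ?fuv (?P s t)"]
        Lip has_real_derivative_plane[OF x P] d3) auto
  also have "L * (\<bar>s\<bar> + \<bar>t\<bar>)\<^sup>2 \<le> L * (\<bar>a\<bar> + \<bar>b\<bar>)\<^sup>2"
    using L st by (intro mult_left_mono power_mono) auto
  finally show ?thesis unfolding * abs_divide by simp
qed

text \<open>The inclusion of balls forces \<open>\<bar>a\<bar> + r \<le> \<Delta>\<close>. Points of
  the rectangle have distance at most \<open>sqrt (a\<^sup>2 + b\<^sup>2)\<close> from
  \<open>x\<close>, strictly below \<open>\<bar>a\<bar> + \<bar>b\<bar>\<close> as both steps are
  non-zero, so they stay inside the open ball.\<close>

lemma plane_in_vball:
  assumes x: "x \<in> carrier_vec n" and uv: "u < n" "v < n" "u \<noteq> v"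
    and ab: "a \<noteq> 0" "b \<noteq> 0" "\<bar>b\<bar> \<le> r"
    and sub: "vball n (x + a \<cdot>\<^sub>v unit_vec n u) r \<subseteq> vball n x \<Delta>"
    and st: "\<bar>s\<bar> \<le> \<bar>a\<bar>" "\<bar>t\<bar> \<le> \<bar>b\<bar>"
  shows "plane n x u v s t \<in> vball n x \<Delta>"
proof -
  let ?P = "plane n x u v"
  have "\<bar>a\<bar> + r \<le> \<Delta>"
  proof (rule field_le_epsilon)
    fix e :: real assume "e > 0"
    \<comment> \<open>A point of the small ball at distance \<open>c\<close> from its center, pushed
      away from \<open>x\<close>, has distance \<open>\<bar>a\<bar> + c\<close> from
      \<open>x\<close>. The maximum covers the case \<open>e > r\<close>.\<close>
    define c where "c = max 0 (r - e)"
    have c: "0 \<le> c" "c < r" "r \<le> c + e" using \<open>e > 0\<close> ab by (auto simp: c_def)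
    have "?P (a + sgn a * c) 0 - ?P a 0 = ?P (sgn a * c) 0 - ?P 0 0"
      using x by (auto simp: plane_def algebra_simps intro!: eq_vecI)
    then have "vnorm (?P (a + sgn a * c) 0 - ?P a 0) = \<bar>sgn a * c\<bar>"
      using vnorm_plane_diff[OF x uv, of "sgn a * c" 0 0 0] by simp
    also have "\<dots> = c" using c ab by (simp add: abs_mult sgn_if)
    finally have "?P (a + sgn a * c) 0 \<in> vball n (x + a \<cdot>\<^sub>v unit_vec n u) r"
      using x c by (simp add: vball_def plane_zero(1)[of _ _ _ _ a])
    then have "?P (a + sgn a * c) 0 \<in> vball n x \<Delta>"
      using sub by blast
    then have "vnorm (?P (a + sgn a * c) 0 - ?P 0 0) < \<Delta>"
      unfolding plane_zero(3)[OF x] by (simp add: vball_def)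
    then have "\<bar>a + sgn a * c\<bar> < \<Delta>"
      using vnorm_plane_diff[OF x uv, of "a + sgn a * c" 0 0 0] by simp
    then show "\<bar>a\<bar> + r \<le> \<Delta> + e" using c ab by (auto simp: sgn_if abs_if split: if_splits)
  qed
  have "vnorm (?P s t - ?P 0 0) = sqrt (s\<^sup>2 + t\<^sup>2)"
    using vnorm_plane_diff[OF x uv, of s t 0 0] by simp
  also have "\<dots> \<le> sqrt (a\<^sup>2 + b\<^sup>2)"
    using st by (simp add: add_mono abs_le_square_iff)
  also have "\<dots> < \<bar>a\<bar> + \<bar>b\<bar>"
  proof (rule real_less_lsqrt)
    have "0 < 2 * \<bar>a\<bar> * \<bar>b\<bar>" using ab by simp
    then show "a\<^sup>2 + b\<^sup>2 < (\<bar>a\<bar> + \<bar>b\<bar>)\<^sup>2" by (simp add: power2_sum)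
  qed auto
  also have "\<dots> \<le> \<Delta>" using \<open>\<bar>a\<bar> + r \<le> \<Delta>\<close> ab by simp
  finally show ?thesis using x by (simp add: vball_def plane_zero(3))
qed

subsection \<open>Simplex Hessians as scattered difference quotients\<close>

text \<open>Being a sum over the pairs \<open>(j, i)\<close>, it is linear in \<open>q\<close>
  whatever the positions are; that distinct pairs occupy distinct entries comes from
  \<open>scatter_positions\<close>.\<close>

definition scatter_mat ::
  "nat \<Rightarrow> nat \<Rightarrow> (nat \<Rightarrow> nat) \<Rightarrow> (nat \<Rightarrow> nat) \<Rightarrow> (nat \<Rightarrow> nat \<Rightarrow> nat) \<Rightarrow> (nat \<Rightarrow> nat \<Rightarrow> real) \<Rightarrow> real mat" where
  "scatter_mat n m u k v q =
     mat n n (\<lambda>(x, y). \<Sum>j<m. \<Sum>i<k j. if x = u j \<and> y = v j i then q j i else 0)"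

lemma dim_scatter_mat[simp]:
  "dim_row (scatter_mat n m u k v q) = n" "dim_col (scatter_mat n m u k v q) = n"
  by (simp_all add: scatter_mat_def)

lemma scatter_mat_carrier[simp]: "scatter_mat n m u k v q \<in> carrier_mat n n"
  by (simp add: scatter_mat_def)

lemma index_scatter_mat:
  assumes "x < n" "y < n"
  shows "scatter_mat n m u k v q $$ (x, y)
    = (\<Sum>j<m. \<Sum>i<k j. if x = u j \<and> y = v j i then q j i else 0)"
  using assms by (simp add: scatter_mat_def)

lemma scatter_mat_cong:
  assumes "\<And>j i. j < m \<Longrightarrow> i < k j \<Longrightarrow> q j i = q' j i"
  shows "scatter_mat n m u k v q = scatter_mat n m u k v q'"
proof (rule eq_matI)
  fix x y assume "x < dim_row (scatter_mat n m u k v q')" "y < dim_col (scatter_mat n m u k v q')"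
  then have xy: "x < n" "y < n" by simp_all
  show "scatter_mat n m u k v q $$ (x, y) = scatter_mat n m u k v q' $$ (x, y)"
    unfolding index_scatter_mat[OF xy] by (intro sum.cong refl if_cong) (simp add: assms)
qed simp_all

lemma scatter_mat_linear:
  "c \<cdot>\<^sub>m scatter_mat n m u k v q + d \<cdot>\<^sub>m scatter_mat n m u k v q'
    = scatter_mat n m u k v (\<lambda>j i. c * q j i + d * q' j i)" (is "?L = ?R")
proof (rule eq_matI)
  fix x y assume "x < dim_row ?R" "y < dim_col ?R"
  then have xy: "x < n" "y < n" by simp_all
  then have "?L $$ (x, y) = c * scatter_mat n m u k v q $$ (x, y) + d * scatter_mat n m u k v q' $$ (x, y)"
    by simp
  also have "\<dots> = ?R $$ (x, y)"
    unfolding index_scatter_mat[OF xy] sum_distrib_left sum.distrib[symmetric]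
    by (intro sum.cong refl) simp
  finally show "?L $$ (x, y) = ?R $$ (x, y)" .
qed simp_all

lemma scatter_mat_diff:
  "scatter_mat n m u k v q - scatter_mat n m u k v q' = scatter_mat n m u k v (\<lambda>j i. q j i - q' j i)"
proof -
  have "scatter_mat n m u k v q - scatter_mat n m u k v q'
      = 1 \<cdot>\<^sub>m scatter_mat n m u k v q + (- 1) \<cdot>\<^sub>m scatter_mat n m u k v q'"
    by (rule eq_matI) simp_all
  then show ?thesis unfolding scatter_mat_linear by simp
qed

lemma half_scatter_mat_add:
  "(1 / 2) \<cdot>\<^sub>m (scatter_mat n m u k v q + scatter_mat n m u k v q')
    = scatter_mat n m u k v (\<lambda>j i. (q j i + q' j i) / 2)"
proof -
  have "(1 / 2) \<cdot>\<^sub>m (scatter_mat n m u k v q + scatter_mat n m u k v q')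
      = (1 / 2) \<cdot>\<^sub>m scatter_mat n m u k v q + (1 / 2) \<cdot>\<^sub>m scatter_mat n m u k v q'"
    by (rule eq_matI) (simp_all add: add_divide_distrib)
  then show ?thesis unfolding scatter_mat_linear by (simp add: add_divide_distrib)
qed

text \<open>Rows differ for different \<open>j\<close> and columns differ within one
  \<open>j\<close>, so the positions \<open>(u j, v j i)\<close> are pairwise distinct.\<close>

locale scatter_positions =
  fixes n m :: nat and u :: "nat \<Rightarrow> nat" and k :: "nat \<Rightarrow> nat" and v :: "nat \<Rightarrow> nat \<Rightarrow> nat"
  assumes u_inj: "inj_on u {..<m}" and u_less: "\<And>j. j < m \<Longrightarrow> u j < n"
    and v_inj: "\<And>j. j < m \<Longrightarrow> inj_on (v j) {..<k j}"
    and v_less: "\<And>j i. j < m \<Longrightarrow> i < k j \<Longrightarrow> v j i < n"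
begin

lemma scatter_mat_entry:
  assumes "j < m" "i < k j"
  shows "scatter_mat n m u k v q $$ (u j, v j i) = q j i"
proof -
  have "scatter_mat n m u k v q $$ (u j, v j i)
      = (\<Sum>j'<m. \<Sum>i'<k j'. if u j = u j' \<and> v j i = v j' i' then q j' i' else 0)"
    using assms u_less v_less by (simp add: scatter_mat_def)
  also have "\<dots> = (\<Sum>j'<m. if j' = j then \<Sum>i'<k j. if v j i = v j i' then q j i' else 0 else 0)"
    using assms u_inj by (intro sum.cong) (auto dest: inj_onD intro!: sum.neutral)
  also have "\<dots> = (\<Sum>i'<k j. if v j i = v j i' then q j i' else 0)"
    using assms by simp
  also have "\<dots> = (\<Sum>i'<k j. if i' = i then q j i' else 0)"
    using assms v_inj[of j] by (intro sum.cong) (auto dest: inj_onD)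
  also have "\<dots> = q j i" using assms by simp
  finally show ?thesis .
qed

lemma scatter_mat_zero_entry:
  assumes "x < n" "y < n" "\<not> (\<exists>j<m. \<exists>i<k j. x = u j \<and> y = v j i)"
  shows "scatter_mat n m u k v q $$ (x, y) = 0"
  using assms by (auto simp: scatter_mat_def intro!: sum.neutral)

text \<open>Exchanging the sums lets each pair contribute exactly once; applied to squared values it
  evaluates the Frobenius norm.\<close>

lemma sum_entries_scatter_mat:
  "(\<Sum>x<n. \<Sum>y<n. scatter_mat n m u k v q $$ (x, y)) = (\<Sum>j<m. \<Sum>i<k j. q j i)"
proof -
  let ?t = "\<lambda>x y j i. if x = u j \<and> y = v j i then q j i else 0"
  have "(\<Sum>x<n. \<Sum>y<n. scatter_mat n m u k v q $$ (x, y))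
      = (\<Sum>x<n. \<Sum>y<n. \<Sum>j<m. \<Sum>i<k j. ?t x y j i)"
    by (simp add: scatter_mat_def)
  also have "\<dots> = (\<Sum>x<n. \<Sum>j<m. \<Sum>y<n. \<Sum>i<k j. ?t x y j i)"
    by (intro sum.cong refl sum.swap)
  also have "\<dots> = (\<Sum>x<n. \<Sum>j<m. \<Sum>i<k j. \<Sum>y<n. ?t x y j i)"
    by (intro sum.cong refl sum.swap)
  also have "\<dots> = (\<Sum>j<m. \<Sum>x<n. \<Sum>i<k j. \<Sum>y<n. ?t x y j i)"
    by (rule sum.swap)
  also have "\<dots> = (\<Sum>j<m. \<Sum>i<k j. \<Sum>x<n. \<Sum>y<n. ?t x y j i)"
    by (intro sum.cong refl sum.swap)
  also have "\<dots> = (\<Sum>j<m. \<Sum>i<k j. \<Sum>x<n. if x = u j then \<Sum>y<n. if y = v j i then q j i else 0 else 0)"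
    by (intro sum.cong refl) (auto intro!: sum.cong)
  also have "\<dots> = (\<Sum>j<m. \<Sum>i<k j. q j i)"
    using u_less v_less by (intro sum.cong) auto
  finally show ?thesis .
qed

text \<open>At most \<open>m * K\<close> entries are non-zero, each of modulus at most
  \<open>c\<close>; the Frobenius norm bounds the spectral norm.\<close>

lemma mat_norm_scatter_mat_le:
  assumes q: "\<And>j i. j < m \<Longrightarrow> i < k j \<Longrightarrow> \<bar>q j i\<bar> \<le> c" and "0 \<le> c"
    and K: "\<And>j. j < m \<Longrightarrow> k j \<le> K"
  shows "mat_norm (scatter_mat n m u k v q) \<le> sqrt (real (m * K)) * c"
proof -
  \<comment> \<open>Squaring commutes with scattering because no entry receives two terms.\<close>
  have sq: "(scatter_mat n m u k v q $$ (x, y))\<^sup>2 = scatter_mat n m u k v (\<lambda>j i. (q j i)\<^sup>2) $$ (x, y)"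
    if "x < n" "y < n" for x y
  proof (cases "\<exists>j<m. \<exists>i<k j. x = u j \<and> y = v j i")
    case True
    then show ?thesis by (auto simp: scatter_mat_entry)
  next
    case False
    then show ?thesis using that by (simp add: scatter_mat_zero_entry)
  qed
  have "(\<Sum>x<n. \<Sum>y<n. (scatter_mat n m u k v q $$ (x, y))\<^sup>2) = (\<Sum>j<m. \<Sum>i<k j. (q j i)\<^sup>2)"
    by (simp add: sq sum_entries_scatter_mat)
  also have "\<dots> \<le> (\<Sum>j<m. \<Sum>i<k j. c\<^sup>2)"
    using q by (intro sum_mono) (auto simp: abs_le_square_iff[symmetric] \<open>0 \<le> c\<close>)
  also have "\<dots> \<le> (\<Sum>j<m. real K * c\<^sup>2)"
    using K by (intro sum_mono) (simp add: mult_right_mono)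
  finally have "(\<Sum>x<n. \<Sum>y<n. (scatter_mat n m u k v q $$ (x, y))\<^sup>2) \<le> real (m * K) * c\<^sup>2"
    by simp
  then have "sqrt (\<Sum>x<n. \<Sum>y<n. (scatter_mat n m u k v q $$ (x, y))\<^sup>2) \<le> sqrt (real (m * K) * c\<^sup>2)"
    by simp
  also have "\<dots> = sqrt (real (m * K)) * c"
    using \<open>0 \<le> c\<close> by (simp add: real_sqrt_mult)
  finally show ?thesis
    using mat_norm_le_frobenius[of "scatter_mat n m u k v q"] by simp
qed

text \<open>With the explicit pseudoinverse, the gradient consists of forward difference quotients
  in the selected directions.\<close>

lemma simplex_gradient_sel_mat:
  assumes j: "j < m" and b: "\<And>i. i < k j \<Longrightarrow> b i \<noteq> 0" and y: "y < n"
  shows "simplex_gradient f x (sel_mat n (k j) (v j) b) $ y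
    = (\<Sum>i<k j. if y = v j i then (f (x + b i \<cdot>\<^sub>v unit_vec n (v j i)) - f x) / b i else 0)"
proof -
  have "pinv ((sel_mat n (k j) (v j) b)\<^sup>T) = sel_mat n (k j) (v j) (\<lambda>i. 1 / b i)"
    using v_inj[OF j] v_less[OF j] b by (intro pinv_sel_mat) auto
  then have "simplex_gradient f x (sel_mat n (k j) (v j) b) $ y
      = (\<Sum>i<k j. sel_mat n (k j) (v j) (\<lambda>i. 1 / b i) $$ (y, i)
          * simplex_delta f x (sel_mat n (k j) (v j) b) $ i)"
    using y by (simp add: simplex_gradient_def scalar_prod_def simplex_delta_def atLeast0LessThan)
  also have "\<dots> = (\<Sum>i<k j. if y = v j i then (f (x + b i \<cdot>\<^sub>v unit_vec n (v j i)) - f x) / b i else 0)"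
    using y by (intro sum.cong) (auto simp: simplex_delta_def col_sel_mat)
  finally show ?thesis .
qed

lemma dim_simplex_gradient_sel_mat:
  assumes j: "j < m" and b: "\<And>i. i < k j \<Longrightarrow> b i \<noteq> 0"
  shows "dim_vec (simplex_gradient f x (sel_mat n (k j) (v j) b)) = n"
proof -
  have "pinv ((sel_mat n (k j) (v j) b)\<^sup>T) = sel_mat n (k j) (v j) (\<lambda>i. 1 / b i)"
    using v_inj[OF j] v_less[OF j] b by (intro pinv_sel_mat) auto
  then show ?thesis by (simp add: simplex_gradient_def)
qed

text \<open>Row \<open>j\<close> of \<open>simplex_delta2\<close> is a difference of forward
  quotients at two base points; the weight \<open>1 / a j\<close> from \<open>pinv\<close> turns it
  into mixed quotients and places it in row \<open>u j\<close>.\<close>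

lemma simplex_hessian_sel_mat:
  assumes x: "x \<in> carrier_vec n"
    and a: "\<And>j. j < m \<Longrightarrow> a j \<noteq> 0" and b: "\<And>j i. j < m \<Longrightarrow> i < k j \<Longrightarrow> b j i \<noteq> 0"
    and Ts: "\<And>j. j < m \<Longrightarrow> Ts j = sel_mat n (k j) (v j) (b j)"
  shows "simplex_hessian f x (sel_mat n m u a) Ts
    = scatter_mat n m u k v (\<lambda>j i. mixed_quotient n f x (u j) (v j i) (a j) (b j i))"
    (is "?H = ?R")
proof (rule eq_matI)
  let ?S = "sel_mat n m u a"
  have pS: "pinv (?S\<^sup>T) = sel_mat n m u (\<lambda>j. 1 / a j)"
    using u_inj u_less a by (intro pinv_sel_mat) auto
  have d2: "simplex_delta2 f x ?S Ts \<in> carrier_mat m n"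
    by (intro carrier_matI) (simp_all add: simplex_delta2_def)
  show "dim_row ?H = dim_row ?R" "dim_col ?H = dim_col ?R"
    using d2 by (simp_all add: simplex_hessian_def pS)
  fix r c assume "r < dim_row ?R" "c < dim_col ?R"
  then have rc: "r < n" "c < n" by auto
  have "?H $$ (r, c) = (\<Sum>j<m. sel_mat n m u (\<lambda>j. 1 / a j) $$ (r, j) * simplex_delta2 f x ?S Ts $$ (j, c))"
    unfolding simplex_hessian_def pS by (rule index_mult_mat_sum) (use d2 rc in auto)
  also have "\<dots> = (\<Sum>j<m. \<Sum>i<k j. if r = u j \<and> c = v j i
      then mixed_quotient n f x (u j) (v j i) (a j) (b j i) else 0)"
  proof (intro sum.cong refl)
    fix j assume "j \<in> {..<m}"
    then have j: "j < m" by simp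
    have "simplex_delta2 f x ?S Ts $$ (j, c)
        = simplex_gradient f (x + a j \<cdot>\<^sub>v unit_vec n (u j)) (Ts j) $ c - simplex_gradient f x (Ts j) $ c"
      unfolding simplex_delta2_def using j rc b
      by (simp add: mat_of_rows_index Ts dim_simplex_gradient_sel_mat col_sel_mat)
    also have "\<dots> = (\<Sum>i<k j. if c = v j i
        then a j * mixed_quotient n f x (u j) (v j i) (a j) (b j i) else 0)"
    proof -
      \<comment> \<open>For \<open>t = 0\<close> both sides vanish, since division by zero gives
        0.\<close>
      have "(p - q) / t - (r - s) / t = a j * ((p - q - (r - s)) / (a j * t))" for p q r s t
        using a[OF j] by (cases "t = 0") (simp_all add: field_simps)
      moreover have "simplex_gradient f z (Ts j) $ c
          = (\<Sum>i<k j. if c = v j i then (f (z + b j i \<cdot>\<^sub>v unit_vec n (v j i)) - f z) / b j i else 0)" for z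
        unfolding Ts[OF j] using j b rc by (intro simplex_gradient_sel_mat)
      ultimately show ?thesis
        unfolding mixed_quotient_eq[OF x]
        by (auto simp flip: sum_subtractf intro!: sum.cong)
    qed
    finally show "sel_mat n m u (\<lambda>j. 1 / a j) $$ (r, j) * simplex_delta2 f x ?S Ts $$ (j, c)
        = (\<Sum>i<k j. if r = u j \<and> c = v j i
            then mixed_quotient n f x (u j) (v j i) (a j) (b j i) else 0)"
      using j rc a[OF j] by (auto simp: sum_distrib_left intro!: sum.cong)
  qed
  finally show "?H $$ (r, c) = ?R $$ (r, c)"
    using rc by (simp add: scatter_mat_def)
qed

text \<open>In each summand the factors left of \<open>M\<close> keep only row \<open>u j\<close>,
  those on its right only the columns \<open>v j i\<close>, and all weights cancel.\<close>

lemma simplex_proj_sel_mat: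
  assumes M: "M \<in> carrier_mat n n"
    and a: "\<And>j. j < m \<Longrightarrow> a j \<noteq> 0" and b: "\<And>j i. j < m \<Longrightarrow> i < k j \<Longrightarrow> b j i \<noteq> 0"
    and Ts: "\<And>j. j < m \<Longrightarrow> Ts j = sel_mat n (k j) (v j) (b j)"
  shows "simplex_proj (sel_mat n m u a) Ts M = scatter_mat n m u k v (\<lambda>j i. M $$ (u j, v j i))"
proof -
  let ?S = "sel_mat n m u a" and ?e = "\<lambda>j. mat_of_cols m [unit_vec m j] :: real mat"
  have pS: "pinv (?S\<^sup>T) = sel_mat n m u (\<lambda>j. 1 / a j)"
    using u_inj u_less a by (intro pinv_sel_mat) auto
  have "(pinv (?S\<^sup>T) * ?e j * (?e j)\<^sup>T * ?S\<^sup>T * M * Ts j * pinv (Ts j)) $$ (x, y)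
      = (\<Sum>i<k j. if x = u j \<and> y = v j i then M $$ (u j, v j i) else 0)"
    if j: "j < m" and xy: "x < n" "y < n" for j x y
  proof -
    have e: "?e j \<in> carrier_mat m 1" by (intro carrier_matI) auto
    then have eT: "(?e j)\<^sup>T \<in> carrier_mat 1 m" by (simp only: transpose_carrier_mat)
    have pT: "pinv (Ts j) = (sel_mat n (k j) (v j) (\<lambda>i. 1 / b j i))\<^sup>T"
      unfolding Ts[OF j] using v_inj[OF j] v_less[OF j] b[OF j] by (intro pinv_sel_mat) auto
    have e_entry: "?e j $$ (l, 0) = (if l = j then 1 else 0)" if "l < m" for l
      using that j by (simp add: mat_of_cols_index)
    \<comment> \<open>The product is evaluated from left to right; in each of these partial products
      at most one inner index contributes.\<close>
    define W1 where "W1 = pinv (?S\<^sup>T) * ?e j"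
    define W2 where "W2 = W1 * (?e j)\<^sup>T"
    define W3 where "W3 = W2 * ?S\<^sup>T"
    define W4 where "W4 = W3 * M"
    define W5 where "W5 = W4 * Ts j"
    have W1: "W1 \<in> carrier_mat n 1"
      unfolding W1_def pS by (rule mult_carrier_mat[OF sel_mat_carrier e])
    have W2: "W2 \<in> carrier_mat n m"
      unfolding W2_def by (rule mult_carrier_mat[OF W1 eT])
    have W3: "W3 \<in> carrier_mat n n"
      unfolding W3_def by (rule mult_carrier_mat[OF W2]) simp
    have W4: "W4 \<in> carrier_mat n n"
      unfolding W4_def by (rule mult_carrier_mat[OF W3 M])
    have W5: "W5 \<in> carrier_mat n (k j)"
      unfolding W5_def Ts[OF j] by (rule mult_carrier_mat[OF W4 sel_mat_carrier])
    have W1e: "W1 $$ (r, 0) = (if r = u j then 1 / a j else 0)" if "r < n" for r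
    proof -
      have "W1 $$ (r, 0) = (\<Sum>l<m. sel_mat n m u (\<lambda>j. 1 / a j) $$ (r, l) * ?e j $$ (l, 0))"
        unfolding W1_def pS using that e by (intro index_mult_mat_sum) auto
      also have "\<dots> = (\<Sum>l<m. if l = j then (if r = u j then 1 / a j else 0) else 0)"
        using that by (intro sum.cong) (auto simp: e_entry)
      finally show ?thesis using j by simp
    qed
    have W2e: "W2 $$ (r, l) = (if l = j then (if r = u j then 1 / a j else 0) else 0)"
      if "r < n" "l < m" for r l
    proof -
      have "W2 $$ (r, l) = (\<Sum>p<1. W1 $$ (r, p) * (?e j)\<^sup>T $$ (p, l))"
        unfolding W2_def using that W1 by (intro index_mult_mat_sum) auto
      then show ?thesis using that by (simp add: W1e e_entry)
    qed
    \<comment> \<open>Here \<open>a j\<close> cancels against its reciprocal, leaving the matrix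
      unit at \<open>(u j, u j)\<close>.\<close>
    have W3e: "W3 $$ (r, c) = (if c = u j then (if r = u j then 1 else 0) else 0)"
      if "r < n" "c < n" for r c
    proof -
      have "W3 $$ (r, c) = (\<Sum>l<m. W2 $$ (r, l) * ?S\<^sup>T $$ (l, c))"
        unfolding W3_def using that W2 by (intro index_mult_mat_sum) auto
      also have "\<dots> = (\<Sum>l<m. if l = j then (if c = u j then (if r = u j then 1 else 0) else 0) else 0)"
        using that a by (intro sum.cong) (auto simp: W2e)
      finally show ?thesis using j by simp
    qed
    have W4e: "W4 $$ (r, c) = (if r = u j then M $$ (u j, c) else 0)" if "r < n" "c < n" for r c
    proof -
      have "W4 $$ (r, c) = (\<Sum>l<n. W3 $$ (r, l) * M $$ (l, c))"
        unfolding W4_def using that W3 M by (intro index_mult_mat_sum) auto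
      also have "\<dots> = (\<Sum>l<n. if l = u j then (if r = u j then M $$ (u j, c) else 0) else 0)"
        using that by (intro sum.cong) (auto simp: W3e)
      finally show ?thesis using u_less[OF j] by simp
    qed
    have W5e: "W5 $$ (r, i) = (if r = u j then M $$ (u j, v j i) * b j i else 0)"
      if "r < n" "i < k j" for r i
    proof -
      have "W5 $$ (r, i) = (\<Sum>l<n. W4 $$ (r, l) * sel_mat n (k j) (v j) (b j) $$ (l, i))"
        unfolding W5_def Ts[OF j] using that W4 by (intro index_mult_mat_sum) auto
      also have "\<dots> = (\<Sum>l<n. if l = v j i then (if r = u j then M $$ (u j, v j i) * b j i else 0) else 0)"
        using that by (intro sum.cong) (auto simp: W4e)
      finally show ?thesis using v_less[OF j] that by simp
    qed
    have "(W5 * pinv (Ts j)) $$ (x, y)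
        = (\<Sum>i<k j. W5 $$ (x, i) * (sel_mat n (k j) (v j) (\<lambda>i. 1 / b j i))\<^sup>T $$ (i, y))"
      unfolding pT using xy W5 by (intro index_mult_mat_sum) auto
    also have "\<dots> = (\<Sum>i<k j. if x = u j \<and> y = v j i then M $$ (u j, v j i) else 0)"
      using xy b[OF j] by (intro sum.cong) (auto simp: W5e)
    finally show ?thesis by (simp add: W1_def W2_def W3_def W4_def W5_def)
  qed
  then show ?thesis
    unfolding simplex_proj_def scatter_mat_def Let_def
    by (intro eq_matI) (auto intro!: sum.cong)
qed

end

section \<open>Explicit form of the sampling matrices\<close>

text \<open>Each column of \<open>S\<close> is a column of a diagonal matrix, so its non-zero entry
  at \<open>u j\<close> identifies which one. Equal indices would give equal columns, against
  distinctness.\<close>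

lemma formed_by_columns_partial_diagonal:
  assumes S': "partial_diagonal S'" and S: "S \<in> carrier_mat n m" "formed_by_columns S S'"
    and u: "\<And>j. j < m \<Longrightarrow> u j < n \<and> col S j $ u j \<noteq> 0"
  obtains a where "S = sel_mat n m u a" "\<And>j. j < m \<Longrightarrow> a j \<noteq> 0" "inj_on u {..<m}"
proof -
  have n: "dim_row S' = n" using S by (auto simp: formed_by_columns_def)
  obtain E \<iota> where E: "E \<in> carrier_mat n n" "diagonal_mat E"
    and \<iota>: "\<And>q. q < dim_col S' \<Longrightarrow> \<iota> q < n \<and> col S' q = col E (\<iota> q)"
    using S' unfolding partial_diagonal_def n by auto
  have offdiag: "E $$ (x, y) = 0" if "x < n" "y < n" "x \<noteq> y" for x y
    using E that by (auto simp: diagonal_mat_def)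
  have col: "col S j = col E (u j)" if j: "j < m" for j
  proof -
    have "col S j \<in> set (cols S)" using j S by (auto simp: cols_def)
    then have "col S j \<in> set (cols S')" using S by (auto simp: formed_by_columns_def)
    then obtain q where "q < dim_col S'" "col S j = col S' q"
      by (auto simp: cols_def)
    then have q: "\<iota> q < n" "col S j = col E (\<iota> q)" using \<iota> by auto
    then have "E $$ (u j, \<iota> q) \<noteq> 0" using u[OF j] E by auto
    then have "u j = \<iota> q" using offdiag u[OF j] q by blast
    then show ?thesis using q by simp
  qed
  have "inj_on u {..<m}"
  proof (rule inj_onI)
    fix j j' assume jj: "j \<in> {..<m}" "j' \<in> {..<m}" and "u j = u j'"
    then have "cols S ! j = cols S ! j'" using S col by auto
    then show "j = j'"
      using S jj by (auto simp: formed_by_columns_def nth_eq_iff_index_eq simp del: cols_nth)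
  qed
  moreover have "S = sel_mat n m u (\<lambda>j. S $$ (u j, j))"
  proof (rule eq_matI)
    fix x j
    assume "x < dim_row (sel_mat n m u (\<lambda>j. S $$ (u j, j)))"
      "j < dim_col (sel_mat n m u (\<lambda>j. S $$ (u j, j)))"
    then have xj: "x < n" "j < m" by auto
    have "S $$ (x, j) = E $$ (x, u j)"
      using arg_cong[OF col[OF xj(2)], of "\<lambda>w. w $ x"] xj S E u by auto
    then show "S $$ (x, j) = sel_mat n m u (\<lambda>j. S $$ (u j, j)) $$ (x, j)"
      using xj u offdiag by auto
  qed (use S in auto)
  moreover have "S $$ (u j, j) \<noteq> 0" if "j < m" for j
    using u[OF that] S that by auto
  ultimately show ?thesis using that by blast
qed

text \<open>Full rank makes the determinant non-zero, and this determinant is the product of the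
  diagonal.\<close>

lemma diagonal_full_rank_nonzero:
  assumes T: "T \<in> carrier_mat n n" "diagonal_mat T" "full_column_rank T" and i: "i < n"
  shows "T $$ (i, i) \<noteq> 0"
proof -
  have "det T \<noteq> 0"
    using T vec_space.det_rank_iff[of T n] by (auto simp: full_column_rank_def rank_mat_def)
  moreover have "det T = prod_list (diag_mat T)"
    using T by (intro det_upper_triangular) (auto simp: diagonal_mat_def upper_triangular_def)
  ultimately show ?thesis
    using T i by (auto simp: prod_list_zero_iff diag_mat_def)
qed

text \<open>The list in \<open>columns_after\<close> starts at \<open>w + 1\<close>, which gives the
  strict inequality \<open>w < v i\<close>; this places all sampled Hessian entries above the
  diagonal.\<close>

lemma formed_by_columns_after_diagonal:
  assumes T: "T \<in> carrier_mat n n" "diagonal_mat T" "full_column_rank T"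
    and A: "A \<in> carrier_mat n c" "formed_by_columns A (columns_after T w)"
  obtains v b where "A = sel_mat n c v b" "\<And>i. i < c \<Longrightarrow> b i \<noteq> 0" "inj_on v {..<c}"
    "\<And>i. i < c \<Longrightarrow> w < v i \<and> v i < n"
proof -
  have offdiag: "T $$ (x, y) = 0" if "x < n" "y < n" "x \<noteq> y" for x y
    using T that by (auto simp: diagonal_mat_def)
  have "\<exists>l. w < l \<and> l < n \<and> col A i = col T l" if i: "i < c" for i
  proof -
    have "col A i \<in> set (cols A)" using i A by (auto simp: cols_def)
    then have "col A i \<in> set (cols (columns_after T w))"
      using A by (auto simp: formed_by_columns_def)
    also have "cols (columns_after T w) = map (col T) [w + 1..<n]"
      unfolding columns_after_def using T by (subst cols_mat_of_cols) auto
    finally obtain l where "l \<in> {w + 1..<n}" "col A i = col T l" by auto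
    then show ?thesis by (intro exI[of _ l]) auto
  qed
  then obtain v where v: "\<And>i. i < c \<Longrightarrow> w < v i \<and> v i < n \<and> col A i = col T (v i)"
    by metis
  have "inj_on v {..<c}"
  proof (rule inj_onI)
    fix j j' assume jj: "j \<in> {..<c}" "j' \<in> {..<c}" and "v j = v j'"
    then have "cols A ! j = cols A ! j'" using A v by auto
    then show "j = j'"
      using A jj by (auto simp: formed_by_columns_def nth_eq_iff_index_eq simp del: cols_nth)
  qed
  moreover have "A = sel_mat n c v (\<lambda>i. T $$ (v i, v i))"
  proof (rule eq_matI)
    fix x i
    assume "x < dim_row (sel_mat n c v (\<lambda>i. T $$ (v i, v i)))"
      "i < dim_col (sel_mat n c v (\<lambda>i. T $$ (v i, v i)))"
    then have xi: "x < n" "i < c" by auto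
    have "A $$ (x, i) = col A i $ x" using xi A by simp
    also have "\<dots> = col T (v i) $ x" using v[OF xi(2)] by simp
    also have "\<dots> = T $$ (x, v i)" using xi T v[OF xi(2)] by simp
    finally have "A $$ (x, i) = T $$ (x, v i)" .
    then show "A $$ (x, i) = sel_mat n c v (\<lambda>i. T $$ (v i, v i)) $$ (x, i)"
      using xi v offdiag by auto
  qed (use A in auto)
  ultimately show ?thesis
    using that v diagonal_full_rank_nonzero[OF T] by blast
qed

lemma C_k_on_Suc_imp: "C_k_on n (Suc k) X f \<Longrightarrow> C_k_on n k X f"
proof (induction k arbitrary: f)
  case 0
  then show ?case by simp
next
  case (Suc k)
  then show ?case
    unfolding C_k_on.simps(2)[of n "Suc k"] C_k_on.simps(2)[of n k X f] by blast
qed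

section \<open>Error bounds for the simplex Hessian and its centered version\<close>

theorem corollary17:
  fixes n m :: nat
    and D :: "real vec set"
    and f :: "real vec \<Rightarrow> real"
    and x0 :: "real vec"
    and \<Delta> L2 L3 :: real
    and S' S T That :: "real mat"
    and Ts :: "nat \<Rightarrow> real mat"
    and u k :: "nat \<Rightarrow> nat"
  assumes "D \<subseteq> carrier_vec n" and "x0 \<in> D" and "\<Delta> > 0"
    and "vball n x0 \<Delta> \<subseteq> D" and "C_k_on n 4 (vball n x0 \<Delta>) f"
    and "L2 \<ge> 0" and "hessian_lipschitz n L2 (vball n x0 \<Delta>) f"
    and "L3 \<ge> 0" and "third_deriv_lipschitz n L3 (vball n x0 \<Delta>) f"
    and "S' \<in> carrier_mat n (n - 1)" and "partial_diagonal S'" and "full_column_rank S'"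
    and "row S' (n - 1) = 0\<^sub>v (n - 1)"
    and "S \<in> carrier_mat n m" and "formed_by_columns S S'"
    and "T \<in> carrier_mat n n" and "diagonal_mat T" and "full_column_rank T"
    and "\<And>j. j < m \<Longrightarrow> u j < n \<and> col S j $ u j \<noteq> 0"
    and "\<And>j. j < m \<Longrightarrow> Ts j \<in> carrier_mat n (k j)"
    and "\<And>j. j < m \<Longrightarrow> formed_by_columns (Ts j) (columns_after T (u j))"
    and "rank_mat S \<noteq> 0" and "\<And>j. j < m \<Longrightarrow> rank_mat (Ts j) \<noteq> 0"
    and "simplex_hessian_defined D x0 S Ts"
    and "centered_simplex_hessian_defined D x0 S Ts"
    and "\<And>j. j < m \<Longrightarrow> vball n (x0 + col S j) (radius (Ts j)) \<subseteq> vball n x0 \<Delta>"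
    and "That \<in> (\<lambda>j. normalized (Ts j)) ` {..<m}"
    and "\<And>j. j < m \<Longrightarrow> mat_norm (pinv (normalized (Ts j))) \<le> mat_norm (pinv That)"
  shows
    "mat_norm (simplex_proj S Ts (simplex_hessian f x0 S Ts) - simplex_proj S Ts (hessian n f x0))
       = mat_norm (simplex_hessian f x0 S Ts - simplex_proj S Ts (strict_upper (hessian n f x0)))
     \<and> mat_norm (simplex_hessian f x0 S Ts - simplex_proj S Ts (strict_upper (hessian n f x0)))
       \<le> 4 * real m * sqrt (real (Max (k ` {..<m}))) * L2 * (radius_u S Ts / radius_l S Ts)\<^sup>2
           * mat_norm (pinv ((normalized S)\<^sup>T)) * mat_norm (pinv That) * radius_u S Ts
     \<and> mat_norm (simplex_proj S Ts (centered_simplex_hessian f x0 S Ts)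
                   - simplex_proj S Ts (hessian n f x0))
       = mat_norm (centered_simplex_hessian f x0 S Ts
                     - simplex_proj S Ts (strict_upper (hessian n f x0)))
     \<and> mat_norm (centered_simplex_hessian f x0 S Ts
                   - simplex_proj S Ts (strict_upper (hessian n f x0)))
       \<le> 2 * real m * sqrt (real (Max (k ` {..<m}))) * L3 * (radius_u S Ts / radius_l S Ts)\<^sup>2
           * mat_norm (pinv ((normalized S)\<^sup>T)) * mat_norm (pinv That) * (radius_u S Ts)\<^sup>2"
proof -
  note ball = assms(26)
  have x0: "x0 \<in> carrier_vec n" using assms(1,2) by blast
  have f3: "C_k_on n 3 (vball n x0 \<Delta>) f"
    using C_k_on_Suc_imp[of n 3] assms(5) by (simp add: eval_nat_numeral)
  then have f2: "C_k_on n 2 (vball n x0 \<Delta>) f"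
    using C_k_on_Suc_imp[of n 2] by (simp add: eval_nat_numeral)
  obtain a where S: "S = sel_mat n m u a" and a: "\<And>j. j < m \<Longrightarrow> a j \<noteq> 0"
    and u_inj: "inj_on u {..<m}"
    using formed_by_columns_partial_diagonal[OF assms(11,14,15,19)] by blast
  have "\<exists>vj bj. Ts j = sel_mat n (k j) vj bj \<and> (\<forall>i<k j. bj i \<noteq> 0) \<and> inj_on vj {..<k j}
      \<and> (\<forall>i<k j. u j < vj i \<and> vj i < n)" if "j < m" for j
    using formed_by_columns_after_diagonal[OF assms(16,17,18) assms(20)[OF that] assms(21)[OF that]]
    by metis
  then obtain v b where Ts: "\<And>j. j < m \<Longrightarrow> Ts j = sel_mat n (k j) (v j) (b j)"
    and b: "\<And>j i. j < m \<Longrightarrow> i < k j \<Longrightarrow> b j i \<noteq> 0"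
    and v_inj: "\<And>j. j < m \<Longrightarrow> inj_on (v j) {..<k j}"
    and v: "\<And>j i. j < m \<Longrightarrow> i < k j \<Longrightarrow> u j < v j i \<and> v j i < n"
    by metis
  have u: "u j < n" if "j < m" for j using assms(19) that by blast
  interpret scatter_positions n m u k v
    by unfold_locales (use u u_inj v v_inj in auto)
  \<comment> \<open>The index set is non-empty because \<open>That\<close> is taken from it.\<close>
  have m: "0 < m" using assms(27) by auto
  have k: "0 < k j" if "j < m" for j
    using assms(20,21)[OF that] by (auto simp: formed_by_columns_def)

  define ru rl where "ru = radius_u S Ts" and "rl = radius_l S Ts"
  have a_le: "\<bar>a j\<bar> \<le> radius S" if "j < m" for j
    unfolding S using that u by (intro abs_le_radius_sel_mat)
  have b_le: "\<bar>b j i\<bar> \<le> radius (Ts j)" if "j < m" "i < k j" for j i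
    unfolding Ts[OF that(1)] using that v by (intro abs_le_radius_sel_mat) auto
  have ru: "radius S \<le> ru" "\<And>j. j < m \<Longrightarrow> radius (Ts j) \<le> ru"
    unfolding ru_def radius_u_def using S by (auto intro!: Max_ge)
  \<comment> \<open>Every matrix has a non-zero column, so all radii are positive and
    \<open>ru / rl\<close> is a genuine ratio, at least 1.\<close>
  have "0 < radius S" using a_le[OF m] a[OF m] by auto
  moreover have "0 < radius (Ts j)" if "j < m" for j
    using b_le[OF that k[OF that]] b[OF that k[OF that]] by auto
  ultimately have "0 < rl" unfolding rl_def radius_l_def using S by auto
  moreover have "rl \<le> radius S" unfolding rl_def radius_l_def by (intro Min_le) auto
  ultimately have ratio: "1 \<le> ru / rl" and ru0: "0 \<le> ru" using ru(1) by auto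
  have a_ru: "\<bar>a j\<bar> \<le> ru" if "j < m" for j using a_le[OF that] ru(1) by simp
  have b_ru: "\<bar>b j i\<bar> \<le> ru" if "j < m" "i < k j" for j i
    using b_le[OF that] ru(2)[OF that(1)] by simp
  \<comment> \<open>\<open>G\<close> collects the factors of the bound that are at least 1; they can
    be multiplied onto any non-negative estimate.\<close>
  define G where "G = (ru / rl)\<^sup>2 * mat_norm (pinv ((normalized S)\<^sup>T)) * mat_norm (pinv That)"
  have "1 \<le> mat_norm (pinv ((normalized S)\<^sup>T))"
    unfolding S using u_inj u a m by (intro mat_norm_pinv_normalized_sel_mat(2))
  moreover have "1 \<le> mat_norm (pinv That)"
  proof -
    obtain j where j: "j < m" "That = normalized (Ts j)" using assms(27) by auto
    show ?thesis
      unfolding j(2) Ts[OF j(1)] using j v_inj v b k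
      by (intro mat_norm_pinv_normalized_sel_mat(1)) auto
  qed
  moreover have "1 \<le> (ru / rl)\<^sup>2" using ratio by (rule one_le_power)
  ultimately have "1 * 1 * 1 \<le> G" unfolding G_def by (intro mult_mono) auto
  then have G: "1 \<le> G" by simp

  define K where "K = Max (k ` {..<m})"
  have K: "k j \<le> K" if "j < m" for j unfolding K_def using that by (intro Max_ge) auto
  have final: "mat_norm (scatter_mat n m u k v q) \<le> real m * sqrt (real K) * c * G"
    if "\<And>j i. j < m \<Longrightarrow> i < k j \<Longrightarrow> \<bar>q j i\<bar> \<le> c" "0 \<le> c" for q c
  proof -
    \<comment> \<open>The factor \<open>m\<close> of the claim arises by weakening
      \<open>sqrt m\<close>, as \<open>m\<close> is at least 1.\<close>
    have "sqrt (real m) \<le> real m"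
      using m by (intro real_le_lsqrt) (auto simp: power2_eq_square)
    then have "sqrt (real (m * K)) \<le> real m * sqrt (real K)"
      by (simp add: real_sqrt_mult mult_right_mono)
    then have "sqrt (real (m * K)) * c \<le> real m * sqrt (real K) * c"
      using that by (intro mult_right_mono)
    also have "\<dots> = real m * sqrt (real K) * c * 1" by simp
    also have "\<dots> \<le> real m * sqrt (real K) * c * G"
      using G that by (intro mult_left_mono) auto
    finally show ?thesis using mat_norm_scatter_mat_le[of q c K] that K by fastforce
  qed

  have pos: "u j < n" "v j i < n" "u j \<noteq> v j i" "a j \<noteq> 0" "b j i \<noteq> 0" if "j < m" "i < k j" for j i
    using that u[OF that(1)] v[OF that] a[OF that(1)] b[OF that] by auto
  have P: "plane n x0 (u j) (v j i) s t \<in> vball n x0 \<Delta>"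
    if "j < m" "i < k j" "\<bar>s\<bar> \<le> \<bar>a j\<bar>" "\<bar>t\<bar> \<le> \<bar>b j i\<bar>" for j i s t
  proof (rule plane_in_vball[OF x0 pos[OF that(1,2)] b_le[OF that(1,2)] _ that(3,4)])
    show "vball n (x0 + a j \<cdot>\<^sub>v unit_vec n (u j)) (radius (Ts j)) \<subseteq> vball n x0 \<Delta>"
      using ball[OF that(1)] that by (simp add: S col_sel_mat)
  qed

  let ?H = "hessian n f x0"
  let ?q = "\<lambda>j i. mixed_quotient n f x0 (u j) (v j i) (a j) (b j i)"
  let ?q' = "\<lambda>j i. mixed_quotient n f x0 (u j) (v j i) (- a j) (- b j i)"
  let ?h = "\<lambda>j i. ?H $$ (u j, v j i)"
  have proj: "simplex_proj S Ts M = scatter_mat n m u k v (\<lambda>j i. M $$ (u j, v j i))"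
    if "M \<in> carrier_mat n n" for M
    unfolding S using that a b Ts by (rule simplex_proj_sel_mat)
  have simplex: "simplex_hessian f x0 S Ts = scatter_mat n m u k v ?q"
    unfolding S using x0 a b Ts by (rule simplex_hessian_sel_mat)
  have "simplex_hessian f x0 (- S) (\<lambda>j. - Ts j) = scatter_mat n m u k v ?q'"
    unfolding S uminus_sel_mat using x0 a b Ts
    by (intro simplex_hessian_sel_mat[where b = "\<lambda>j i. - b j i"]) (auto simp: uminus_sel_mat)
  then have centered: "centered_simplex_hessian f x0 S Ts
      = scatter_mat n m u k v (\<lambda>j i. (?q j i + ?q' j i) / 2)"
    by (simp add: centered_simplex_hessian_def simplex half_scatter_mat_add)
  have H: "?H \<in> carrier_mat n n" "strict_upper ?H \<in> carrier_mat n n"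
    by (simp_all add: hessian_def strict_upper_def)
  have proj_H: "simplex_proj S Ts ?H = scatter_mat n m u k v ?h"
    using proj[OF H(1)] by blast
  have "simplex_proj S Ts (strict_upper ?H) = scatter_mat n m u k v (\<lambda>j i. strict_upper ?H $$ (u j, v j i))"
    using proj[OF H(2)] by blast
  \<comment> \<open>All positions satisfy \<open>u j < v j i\<close>, where
    \<open>strict_upper\<close> leaves the Hessian unchanged.\<close>
  also have "\<dots> = scatter_mat n m u k v ?h"
    using u v H by (intro scatter_mat_cong) (auto simp: strict_upper_def)
  finally have proj_U: "simplex_proj S Ts (strict_upper ?H) = scatter_mat n m u k v ?h" .
  \<comment> \<open>The projection fixes every matrix supported on the positions, in particular both
    simplex Hessians; with \<open>proj_U\<close> and \<open>proj_H\<close> this yields the two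
    claimed equalities.\<close>
  have proj_scatter: "simplex_proj S Ts (scatter_mat n m u k v q) = scatter_mat n m u k v q" for q
  proof -
    have "simplex_proj S Ts (scatter_mat n m u k v q)
        = scatter_mat n m u k v (\<lambda>j i. scatter_mat n m u k v q $$ (u j, v j i))"
      using proj[OF scatter_mat_carrier] by blast
    also have "\<dots> = scatter_mat n m u k v q"
      by (intro scatter_mat_cong scatter_mat_entry)
    finally show ?thesis .
  qed

  have "\<bar>?q j i - ?h j i\<bar> \<le> 4 * L2 * ru" if ji: "j < m" "i < k j" for j i
  proof -
    have "\<bar>?q j i - ?h j i\<bar> \<le> L2 * (\<bar>a j\<bar> + \<bar>b j i\<bar>)"
      by (rule mixed_quotient_error[OF x0 pos[OF ji] P[OF ji] f2 assms(7,6)])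
    \<comment> \<open>The two steps sum to at most \<open>2 * ru\<close>, relaxed here to the
      constant 4 of the claim.\<close>
    also have "\<dots> \<le> L2 * (4 * ru)"
      using a_ru[OF ji(1)] b_ru[OF ji] ru0 assms(6) by (intro mult_left_mono) auto
    finally show ?thesis by simp
  qed
  then have "mat_norm (scatter_mat n m u k v (\<lambda>j i. ?q j i - ?h j i))
      \<le> real m * sqrt (real K) * (4 * L2 * ru) * G"
    using assms(6) ru0 by (intro final) auto
  moreover have "\<bar>(?q j i + ?q' j i) / 2 - ?h j i\<bar> \<le> 2 * L3 * ru\<^sup>2" if ji: "j < m" "i < k j" for j i
  proof -
    have "\<bar>(?q j i + ?q' j i) / 2 - ?h j i\<bar> \<le> L3 * (\<bar>a j\<bar> + \<bar>b j i\<bar>)\<^sup>2 / 2"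
      by (rule centered_mixed_quotient_error[OF x0 pos[OF ji] P[OF ji] f3 assms(9,8)])
    \<comment> \<open>Squaring \<open>2 * ru\<close> and halving gives exactly the constant 2 of the
      claim.\<close>
    also have "\<dots> \<le> L3 * (2 * ru)\<^sup>2 / 2"
      using a_ru[OF ji(1)] b_ru[OF ji] assms(8)
      by (intro divide_right_mono mult_left_mono power_mono) auto
    finally show ?thesis by (simp add: power_mult_distrib)
  qed
  then have "mat_norm (scatter_mat n m u k v (\<lambda>j i. (?q j i + ?q' j i) / 2 - ?h j i))
      \<le> real m * sqrt (real K) * (2 * L3 * ru\<^sup>2) * G"
    using assms(8) by (intro final) auto
  ultimately show ?thesis
    unfolding proj_U proj_H simplex centered proj_scatter scatter_mat_diff
    by (simp add: G_def K_def ru_def rl_def mult_ac)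
qed

end
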